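(* Let $\mathcal{P}$ be an induced-hereditary property. Then $\mathcal{P}$ has a unique factorisation (into arbitrary, not necessarily induced-hereditary, properties) if and only if one of the following holds: (1) $\mathcal{P}$ is irreducible; (2) $\mathcal{P} = \mathcal{O}(r)\circ\mathcal{O}(s)$ for some $r,s\le\infty$; (3) $\mathcal{P} = \mathcal{K}(r)\circ\mathcal{K}(s)$ for some $r,s\le\infty$; (4) $\mathcal{P} = \mathcal{O}(r)\circ\mathcal{K}(s)$ for some finite $r,s$.
   Context: All graphs are finite, simple and unlabelled. A property is a set of graphs; it is induced-hereditary if it is closed under taking induced subgraphs. For properties $\mathcal{P}_1,\mathcal{P}_2$, the product $\mathcal{P}_1\circ\mathcal{P}_2$ is the set of graphs $G$ whose vertex set can be partitioned into (possibly empty) sets $A,B$ with $G[A]\in\mathcal{P}_1$ and $G[B]\in\mathcal{P}_2$; products of more factors are defined analogously. A property is reducible if it is the product of two other properties, and irreducible otherwise. $\mathcal{P}$ has a unique factorisation if there is exactly one way, up to the order of the factors, to write $\mathcal{P}$ as a product of irreducible properties (for an irreducible property this is $\mathcal{P}$ itself). For a positive integer $s$, $\mathcal{O}(s)=\{\overline{K}_t \mid 1\le t\le s\}$ (edgeless graphs on at most $s$ vertices) and $\mathcal{K}(s)=\{K_t\mid 1\le t\le s\}$; $\mathcal{O}(\infty)$ is the set of all finite edgeless graphs and $\mathcal{K}(\infty)$ the set of all finite complete graphs. *)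

theory Defs
  imports "HOL-Library.Extended_Nat" "HOL-Library.Multiset" "HOL-Library.Disjoint_Sets"
begin

text \<open>
  Unlabelled finite graphs are represented by labelled graphs \<open>(V, E)\<close> with \<open>V\<close> a finite set of
  naturals; a property is an isomorphism-closed set of such graphs, so that equality of properties
  is equality of sets. The null graph is not a graph here: \<open>\<O>(s)\<close> and \<open>\<K>(s)\<close> start at one vertex, and
  an empty part of a vertex partition satisfies every property.
\<close>

type_synonym graph = "nat set \<times> nat set set"

abbreviation verts :: "graph \<Rightarrow> nat set" where "verts \<equiv> fst"
abbreviation edges :: "graph \<Rightarrow> nat set set" where "edges \<equiv> snd"

definition graphs :: "graph set" where
  "graphs = {G. finite (verts G) \<and> verts G \<noteq> {} \<and> (\<forall>e\<in>edges G. e \<subseteq> verts G \<and> card e = 2)}"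

definition induced :: "graph \<Rightarrow> nat set \<Rightarrow> graph" where
  "induced G A = (A, {e \<in> edges G. e \<subseteq> A})"

definition graph_iso :: "graph \<Rightarrow> graph \<Rightarrow> bool" where
  "graph_iso G H \<longleftrightarrow> (\<exists>f. bij_betw f (verts G) (verts H) \<and> edges H = (\<lambda>e. f ` e) ` edges G)"

definition graph_property :: "graph set \<Rightarrow> bool" where
  "graph_property P \<longleftrightarrow> P \<subseteq> graphs \<and> (\<forall>G\<in>P. \<forall>H\<in>graphs. graph_iso G H \<longrightarrow> H \<in> P)"

definition induced_hereditary :: "graph set \<Rightarrow> bool" where
  "induced_hereditary P \<longleftrightarrow> (\<forall>G\<in>P. \<forall>A. A \<subseteq> verts G \<and> A \<noteq> {} \<longrightarrow> induced G A \<in> P)"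

definition gprod :: "graph set \<Rightarrow> graph set \<Rightarrow> graph set" (infixl "\<odot>" 70) where
  "P \<odot> Q = {G \<in> graphs. \<exists>A B. A \<union> B = verts G \<and> A \<inter> B = {} \<and>
     (A = {} \<or> induced G A \<in> P) \<and> (B = {} \<or> induced G B \<in> Q)}"

definition gprods :: "graph set list \<Rightarrow> graph set" where
  "gprods Ps = {G \<in> graphs. \<exists>A :: nat \<Rightarrow> nat set.
     (\<Union>i<length Ps. A i) = verts G \<and> disjoint_family_on A {..<length Ps} \<and>
     (\<forall>i<length Ps. A i = {} \<or> induced G (A i) \<in> Ps ! i)}"

definition reducible_property :: "graph set \<Rightarrow> bool" where
  "reducible_property P \<longleftrightarrow>
     (\<exists>Q R. graph_property Q \<and> graph_property R \<and> Q \<noteq> P \<and> R \<noteq> P \<and> P = Q \<odot> R)"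

definition irreducible_property :: "graph set \<Rightarrow> bool" where
  "irreducible_property P \<longleftrightarrow> graph_property P \<and> \<not> reducible_property P"

text \<open>
  The empty property is the identity of the product and is itself irreducible, so it must not occur
  as a padding factor: otherwise no property would factor uniquely. It is allowed only as the sole
  factor, i.e. as the factorisation of the empty property itself.
\<close>

definition factorisation :: "graph set list \<Rightarrow> graph set \<Rightarrow> bool" where
  "factorisation Ps P \<longleftrightarrow> Ps \<noteq> [] \<and> (\<forall>Q\<in>set Ps. irreducible_property Q) \<and>
     (length Ps > 1 \<longrightarrow> {} \<notin> set Ps) \<and> P = gprods Ps"

definition unique_factorisation :: "graph set \<Rightarrow> bool" where
  "unique_factorisation P \<longleftrightarrow>
     (\<exists>Ps. factorisation Ps P \<and> (\<forall>Qs. factorisation Qs P \<longrightarrow> mset Qs = mset Ps))"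

definition edgeless_upto :: "enat \<Rightarrow> graph set" where
  "edgeless_upto s = {G \<in> graphs. edges G = {} \<and> enat (card (verts G)) \<le> s}"

definition complete_upto :: "enat \<Rightarrow> graph set" where
  "complete_upto s = {G \<in> graphs. edges G = {e. e \<subseteq> verts G \<and> card e = 2} \<and>
     enat (card (verts G)) \<le> s}"

lemma gprods_pair: "gprods [P, Q] = P \<odot> Q"
proof (intro set_eqI iffI)
  fix G assume "G \<in> gprods [P, Q]"
  then obtain A where G: "G \<in> graphs" and A: "(\<Union>i<2. A i) = verts G"
    "disjoint_family_on A {..<2::nat}" "\<forall>i<2. A i = {} \<or> induced G (A i) \<in> [P, Q] ! i"
    by (auto simp: gprods_def numeral_2_eq_2)
  have "A 0 \<union> A 1 = verts G" using A(1) by (auto simp: numeral_2_eq_2 lessThan_Suc)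
  moreover have "A 0 \<inter> A 1 = {}" using A(2) by (auto simp: disjoint_family_on_def)
  moreover have "A 0 = {} \<or> induced G (A 0) \<in> P" "A 1 = {} \<or> induced G (A 1) \<in> Q"
    using A(3)[rule_format, of 0] A(3)[rule_format, of 1] by auto
  ultimately show "G \<in> P \<odot> Q" using G unfolding gprod_def by blast
next
  fix G assume "G \<in> P \<odot> Q"
  then obtain A B where G: "G \<in> graphs" and AB: "A \<union> B = verts G" "A \<inter> B = {}"
    "A = {} \<or> induced G A \<in> P" "B = {} \<or> induced G B \<in> Q"
    unfolding gprod_def by blast
  show "G \<in> gprods [P, Q]"
    unfolding gprods_def using G AB
    by (auto intro!: exI[of _ "\<lambda>i::nat. if i = 0 then A else B"]
             simp: disjoint_family_on_def lessThan_Suc less_Suc_eq)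
qed

end

theory Submission
  imports Defs "HOL-Library.Nat_Bijection"
begin

text \<open>
  Let \<open>P = Q \<odot> R\<close> with nonempty factors. If \<open>P = P \<odot> R\<close> then \<open>P\<close> is the class of all graphs, since
  \<open>n\<close> nonempty factors produce every graph on \<open>n\<close> vertices as an induced subgraph. For the same
  reason factors of any other \<open>P\<close> split into finitely many irreducible ones, so unique factorisation
  allows one to cancel: \<open>Q \<odot> R = Q' \<odot> R\<close> implies \<open>Q = Q'\<close>. Cancelling against the hereditary closure
  of \<open>Q\<close> shows that \<open>Q\<close> is hereditary. Cancelling against \<open>Q\<close> without the one-vertex graph shows
  that \<open>Q\<close> does not contain both graphs on two vertices (otherwise the removed vertex can be
  replaced by a pair), so \<open>Q\<close> is \<open>\<O>(r)\<close> or \<open>\<K>(r)\<close>, and that \<open>\<O>(r) \<odot> \<K>(\<infinity>)\<close> with \<open>r \<ge> 2\<close> is not unique.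

  Conversely, in \<open>\<O>(r) \<odot> \<O>(s)\<close> all factors are edgeless since triangles are excluded, and the
  complete bipartite graphs, which split into edgeless parts in only one way, determine them. In
  \<open>\<O>(r) \<odot> \<K>(s)\<close> the exclusion of \<open>2K\<^sub>2\<close> and \<open>C\<^sub>4\<close> makes one factor edgeless and the other complete;
  split graphs with parts of orders \<open>a \<le> r\<close> and \<open>s\<close> then force all orders.

  Edges and non-edges are treated symmetrically as the two colours of pairs of vertices.
\<close>

section \<open>Graphs and embeddings\<close>

definition adj :: "graph \<Rightarrow> nat \<Rightarrow> nat \<Rightarrow> bool" where
  "adj G u v \<longleftrightarrow> {u, v} \<in> edges G"

lemma adj_commute: "adj G u v = adj G v u"
  by (simp add: adj_def insert_commute)

lemma edges_conv_adj:
  assumes "G \<in> graphs"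
  shows "edges G = {{u, v} |u v. u \<in> verts G \<and> v \<in> verts G \<and> u \<noteq> v \<and> adj G u v}"
proof -
  have "\<exists>u v. e = {u, v} \<and> u \<in> verts G \<and> v \<in> verts G \<and> u \<noteq> v \<and> adj G u v"
    if "e \<in> edges G" for e
  proof -
    have "card e = 2" "e \<subseteq> verts G" using assms that by (auto simp: graphs_def)
    then show ?thesis using that by (auto simp: card_2_iff adj_def)
  qed
  then show ?thesis by (auto simp: adj_def)
qed

lemma finite_verts: "G \<in> graphs \<Longrightarrow> finite (verts G)"
  by (simp add: graphs_def)

lemma verts_nonempty: "G \<in> graphs \<Longrightarrow> verts G \<noteq> {}"
  by (simp add: graphs_def)

lemma card_verts_pos: "G \<in> graphs \<Longrightarrow> 1 \<le> card (verts G)"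
  by (simp add: finite_verts verts_nonempty Suc_le_eq card_gt_0_iff)

lemma verts_induced [simp]: "verts (induced G A) = A"
  by (simp add: induced_def)

lemma adj_induced [simp]: "u \<in> A \<Longrightarrow> v \<in> A \<Longrightarrow> adj (induced G A) u v = adj G u v"
  by (simp add: adj_def induced_def)

lemma induced_induced: "B \<subseteq> A \<Longrightarrow> induced (induced G A) B = induced G B"
  by (auto simp: induced_def)

lemma induced_verts: "G \<in> graphs \<Longrightarrow> induced G (verts G) = G"
  by (auto simp: induced_def graphs_def prod_eq_iff)

lemma induced_in_graphs: "G \<in> graphs \<Longrightarrow> A \<subseteq> verts G \<Longrightarrow> A \<noteq> {} \<Longrightarrow> induced G A \<in> graphs"
  by (auto simp: induced_def graphs_def intro: finite_subset)

definition mkgraph :: "nat set \<Rightarrow> (nat \<Rightarrow> nat \<Rightarrow> bool) \<Rightarrow> graph" where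
  "mkgraph V E = (V, {{u, v} |u v. u \<in> V \<and> v \<in> V \<and> u \<noteq> v \<and> E u v})"

lemma verts_mkgraph [simp]: "verts (mkgraph V E) = V"
  by (simp add: mkgraph_def)

lemma mkgraph_in_graphs: "finite V \<Longrightarrow> V \<noteq> {} \<Longrightarrow> mkgraph V E \<in> graphs"
  by (auto simp: mkgraph_def graphs_def)

lemma adj_mkgraph:
  "u \<in> V \<Longrightarrow> v \<in> V \<Longrightarrow> u \<noteq> v \<Longrightarrow> E u v = E v u \<Longrightarrow> adj (mkgraph V E) u v = E u v"
  by (auto simp: adj_def mkgraph_def doubleton_eq_iff)

definition embeds :: "(nat \<Rightarrow> nat) \<Rightarrow> graph \<Rightarrow> graph \<Rightarrow> bool" where
  "embeds f G H \<longleftrightarrow> inj_on f (verts G) \<and> f ` verts G \<subseteq> verts H \<and>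
     (\<forall>u\<in>verts G. \<forall>v\<in>verts G. u \<noteq> v \<longrightarrow> adj H (f u) (f v) = adj G u v)"

lemma embeds_adj:
  "embeds f G H \<Longrightarrow> u \<in> verts G \<Longrightarrow> v \<in> verts G \<Longrightarrow> u \<noteq> v \<Longrightarrow> adj H (f u) (f v) = adj G u v"
  by (simp add: embeds_def)

lemma embeds_inj_on: "embeds f G H \<Longrightarrow> inj_on f (verts G)"
  by (simp add: embeds_def)

lemma embeds_image_subset: "embeds f G H \<Longrightarrow> f ` verts G \<subseteq> verts H"
  by (simp add: embeds_def)

lemma embeds_refl: "embeds id G G"
  by (simp add: embeds_def)

lemma embeds_induced_id: "A \<subseteq> verts G \<Longrightarrow> embeds id (induced G A) G"
  by (auto simp: embeds_def)

lemma embeds_induced: "embeds f G H \<Longrightarrow> A \<subseteq> verts G \<Longrightarrow> embeds f (induced G A) (induced H (f ` A))"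
  by (auto simp: embeds_def subset_iff intro: inj_on_subset)

lemma embeds_comp:
  assumes f: "embeds f G H" and g: "embeds g H K"
  shows "embeds (g \<circ> f) G K"
proof -
  have "inj_on (g \<circ> f) (verts G)"
    using embeds_inj_on[OF f] embeds_inj_on[OF g] embeds_image_subset[OF f]
    by (meson comp_inj_on inj_on_subset)
  moreover have "f u \<noteq> f v" if "u \<in> verts G" "v \<in> verts G" "u \<noteq> v" for u v
    using embeds_inj_on[OF f] that by (auto dest: inj_onD)
  ultimately show ?thesis
    using f g unfolding embeds_def by (auto simp: image_subset_iff)
qed

lemma embeds_inv_into:
  assumes f: "embeds f G H" and onto: "f ` verts G = verts H"
  shows "embeds (inv_into (verts G) f) H G"
proof -
  let ?g = "inv_into (verts G) f"
  have "adj G (?g (f u)) (?g (f v)) = adj H (f u) (f v)"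
    if "u \<in> verts G" "v \<in> verts G" "f u \<noteq> f v" for u v
    using embeds_adj[OF f, of u v] embeds_inj_on[OF f] that by force
  moreover have "inj_on ?g (f ` verts G)" by (intro inj_on_inv_into) simp
  moreover have "?g ` f ` verts G \<subseteq> verts G" using embeds_inj_on[OF f] by simp
  ultimately show ?thesis
    unfolding embeds_def onto[symmetric] by simp
qed

lemma graph_iso_imp_embeds:
  assumes "G \<in> graphs" "graph_iso G H"
  obtains f where "embeds f G H" "f ` verts G = verts H"
proof -
  obtain f where inj: "inj_on f (verts G)" and onto: "f ` verts G = verts H"
    and edges_H: "edges H = (`) f ` edges G"
    using assms(2) by (auto simp: graph_iso_def bij_betw_def)
  have "adj H (f u) (f v) = adj G u v" if "u \<in> verts G" "v \<in> verts G" for u v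
  proof -
    have "edges G \<subseteq> Pow (verts G)" using assms(1) by (auto simp: graphs_def)
    then have "f ` {u, v} \<in> (`) f ` edges G \<longleftrightarrow> {u, v} \<in> edges G"
      using inj_on_image_mem_iff[OF inj_on_image_Pow[OF inj], of "{u, v}" "edges G"] that by simp
    then show ?thesis by (simp add: adj_def edges_H)
  qed
  with inj onto show ?thesis by (intro that[of f]) (simp_all add: embeds_def)
qed

lemma embeds_onto_imp_graph_iso:
  assumes G: "G \<in> graphs" and H: "H \<in> graphs"
    and f: "embeds f G H" and onto: "f ` verts G = verts H"
  shows "graph_iso G H"
proof -
  have adj_iff: "f u \<noteq> f v \<and> adj H (f u) (f v) \<longleftrightarrow> u \<noteq> v \<and> adj G u v"
    if "u \<in> verts G" "v \<in> verts G" for u v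
    using embeds_adj[OF f] embeds_inj_on[OF f] that by (metis inj_onD)
  have "edges H = (`) f ` edges G"
  proof (intro set_eqI iffI)
    fix e assume "e \<in> edges H"
    then obtain x y where "e = {x, y}" "x \<in> f ` verts G" "y \<in> f ` verts G" "x \<noteq> y" "adj H x y"
      unfolding edges_conv_adj[OF H] onto by auto
    then obtain u v where "e = f ` {u, v}" "u \<in> verts G" "v \<in> verts G"
      "f u \<noteq> f v" "adj H (f u) (f v)"
      by auto
    then show "e \<in> (`) f ` edges G"
      using adj_iff by (intro image_eqI[of _ _ "{u, v}"]) (auto simp: adj_def)
  next
    fix e assume "e \<in> (`) f ` edges G"
    then obtain u v where "e = f ` {u, v}" "u \<in> verts G" "v \<in> verts G" "u \<noteq> v" "adj G u v"
      using edges_conv_adj[OF G] by auto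
    then show "e \<in> edges H" using adj_iff by (auto simp: adj_def)
  qed
  then show ?thesis
    using embeds_inj_on[OF f] onto by (auto simp: graph_iso_def bij_betw_def)
qed

lemma property_in_graphs: "graph_property P \<Longrightarrow> G \<in> P \<Longrightarrow> G \<in> graphs"
  by (auto simp: graph_property_def)

lemma property_embeds_onto_iff:
  assumes P: "graph_property P" and G: "G \<in> graphs" and H: "H \<in> graphs"
    and f: "embeds f G H" and onto: "f ` verts G = verts H"
  shows "G \<in> P \<longleftrightarrow> H \<in> P"
proof -
  have "graph_iso G H" using G H f onto by (rule embeds_onto_imp_graph_iso)
  moreover have "inv_into (verts G) f ` verts H = verts G"
    using inv_into_image_cancel[OF embeds_inj_on[OF f] order_refl] onto by simp
  then have "graph_iso H G"
    by (rule embeds_onto_imp_graph_iso[OF H G embeds_inv_into[OF f onto]])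
  ultimately show ?thesis using P G H by (auto simp: graph_property_def)
qed

section \<open>Vertex partitions and products\<close>

definition parts :: "graph set \<Rightarrow> graph \<Rightarrow> nat set set" where
  "parts P G = {A. A \<subseteq> verts G \<and> (A = {} \<or> induced G A \<in> P)}"

lemma empty_in_parts [simp]: "{} \<in> parts P G"
  by (simp add: parts_def)

lemma parts_subset_verts: "A \<in> parts P G \<Longrightarrow> A \<subseteq> verts G"
  by (simp add: parts_def)

lemma finite_part: "G \<in> graphs \<Longrightarrow> A \<in> parts P G \<Longrightarrow> finite A"
  by (meson finite_subset finite_verts parts_subset_verts)

lemma parts_mono: "P \<subseteq> Q \<Longrightarrow> parts P G \<subseteq> parts Q G"
  by (auto simp: parts_def)

lemma parts_induced: "A \<subseteq> verts G \<Longrightarrow> parts P (induced G A) = {B \<in> parts P G. B \<subseteq> A}"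
  by (auto simp: parts_def induced_induced)

lemma parts_subset:
  assumes "induced_hereditary P" "A \<in> parts P G" "B \<subseteq> A"
  shows "B \<in> parts P G"
proof (cases "B = {}")
  case False
  then have "induced G A \<in> P" "A \<subseteq> verts G" using assms(2,3) by (auto simp: parts_def)
  then have "induced (induced G A) B \<in> P"
    using assms(1,3) False unfolding induced_hereditary_def by simp
  then show ?thesis
    using assms(3) \<open>A \<subseteq> verts G\<close> by (simp add: parts_def induced_induced)
qed simp

lemma verts_in_parts_iff: "G \<in> graphs \<Longrightarrow> verts G \<in> parts P G \<longleftrightarrow> G \<in> P"
  by (simp add: parts_def induced_verts verts_nonempty)

lemma image_in_parts_iff:
  assumes P: "graph_property P" and GH: "G \<in> graphs" "H \<in> graphs"
    and f: "embeds f G H" and A: "A \<subseteq> verts G"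
  shows "f ` A \<in> parts P H \<longleftrightarrow> A \<in> parts P G"
proof -
  have fA: "f ` A \<subseteq> verts H" using embeds_image_subset[OF f] A by blast
  have "induced G A \<in> P \<longleftrightarrow> induced H (f ` A) \<in> P" if "A \<noteq> {}"
    using GH A fA that
    by (intro property_embeds_onto_iff[OF P _ _ embeds_induced[OF f A]] induced_in_graphs) auto
  then show ?thesis using A fA by (auto simp: parts_def)
qed

lemma gprodI:
  "G \<in> graphs \<Longrightarrow> A \<in> parts P G \<Longrightarrow> B \<in> parts Q G \<Longrightarrow> A \<union> B = verts G \<Longrightarrow> A \<inter> B = {} \<Longrightarrow> G \<in> P \<odot> Q"
  unfolding gprod_def parts_def by blast

lemma gprodE:
  assumes "G \<in> P \<odot> Q"
  obtains A B where "G \<in> graphs" "A \<in> parts P G" "B \<in> parts Q G" "A \<union> B = verts G" "A \<inter> B = {}"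
  using assms unfolding gprod_def parts_def by blast

lemma card_add_card_partition:
  assumes "G \<in> graphs" "A \<union> B = verts G" "A \<inter> B = {}"
  shows "card A + card B = card (verts G)"
  using assms finite_verts[OF assms(1)] by (metis card_Un_disjoint finite_Un)

lemma gprod_iff:
  "G \<in> P \<odot> Q \<longleftrightarrow> G \<in> graphs \<and> (\<exists>A\<in>parts P G. verts G - A \<in> parts Q G)"
proof
  assume "G \<in> P \<odot> Q"
  then obtain A B where "G \<in> graphs" "A \<in> parts P G" "B \<in> parts Q G" "A \<union> B = verts G" "A \<inter> B = {}"
    by (elim gprodE)
  moreover from this have "B = verts G - A" by blast
  ultimately show "G \<in> graphs \<and> (\<exists>A\<in>parts P G. verts G - A \<in> parts Q G)" by blast
qed (auto intro: gprodI dest: parts_subset_verts)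

lemma parts_gprod:
  assumes "G \<in> graphs"
  shows "parts (P \<odot> Q) G = {A \<union> B |A B. A \<in> parts P G \<and> B \<in> parts Q G \<and> A \<inter> B = {}}"
proof (intro set_eqI iffI)
  fix C assume C: "C \<in> parts (P \<odot> Q) G"
  have "\<exists>A\<in>parts P G. \<exists>B\<in>parts Q G. A \<union> B = C \<and> A \<inter> B = {}"
  proof (cases "C = {}")
    case False
    with C have "induced G C \<in> P \<odot> Q" "C \<subseteq> verts G" by (auto simp: parts_def)
    then show ?thesis by (elim gprodE) (auto simp: parts_induced)
  qed auto
  then show "C \<in> {A \<union> B |A B. A \<in> parts P G \<and> B \<in> parts Q G \<and> A \<inter> B = {}}" by blast
next
  fix C assume "C \<in> {A \<union> B |A B. A \<in> parts P G \<and> B \<in> parts Q G \<and> A \<inter> B = {}}"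
  then obtain A B where AB: "C = A \<union> B" "A \<in> parts P G" "B \<in> parts Q G" "A \<inter> B = {}" by blast
  then have C: "C \<subseteq> verts G" by (auto dest: parts_subset_verts)
  then have "induced G C \<in> P \<odot> Q" if "C \<noteq> {}"
    using AB assms that
    by (intro gprodI[of _ A _ B] induced_in_graphs) (auto simp: parts_induced)
  with C show "C \<in> parts (P \<odot> Q) G" by (auto simp: parts_def)
qed

lemma gprod_subset_graphs: "P \<odot> Q \<subseteq> graphs"
  by (auto simp: gprod_def)

lemma gprod_commute: "P \<odot> Q = Q \<odot> P"
  by (auto simp: gprod_def Un_commute Int_commute)

lemma gprod_mono: "P \<subseteq> P' \<Longrightarrow> Q \<subseteq> Q' \<Longrightarrow> P \<odot> Q \<subseteq> P' \<odot> Q'"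
  unfolding gprod_def by blast

lemma gprod_superset:
  assumes "graph_property P"
  shows "P \<subseteq> P \<odot> Q" "P \<subseteq> Q \<odot> P"
proof -
  have "G \<in> P \<odot> Q" if "G \<in> P" for G
    using assms that
    by (intro gprodI[of G "verts G" _ "{}"]) (auto simp: verts_in_parts_iff property_in_graphs)
  then show "P \<subseteq> P \<odot> Q" "P \<subseteq> Q \<odot> P" by (auto simp: gprod_commute)
qed

lemma gprod_empty:
  assumes "graph_property P"
  shows "P \<odot> {} = P"
proof
  show "P \<odot> {} \<subseteq> P"
  proof
    fix G assume "G \<in> P \<odot> {}"
    then obtain A where "G \<in> graphs" "A \<in> parts P G" "A = verts G"
      by (elim gprodE) (auto simp: parts_def[of "{}"])
    then show "G \<in> P" by (simp add: verts_in_parts_iff)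
  qed
qed (rule gprod_superset[OF assms])

lemma gprod_assoc_subset: "(P \<odot> Q) \<odot> R \<subseteq> P \<odot> (Q \<odot> R)"
proof
  fix G assume "G \<in> (P \<odot> Q) \<odot> R"
  then obtain A B C where G: "G \<in> graphs" and parts: "A \<in> parts P G" "B \<in> parts Q G" "C \<in> parts R G"
    and union: "A \<union> B \<union> C = verts G" and disjoint: "A \<inter> B = {}" "(A \<union> B) \<inter> C = {}"
    by (elim gprodE) (auto simp: parts_gprod)
  moreover have "B \<union> C \<in> parts (Q \<odot> R) G"
    using G parts disjoint by (auto simp: parts_gprod)
  ultimately show "G \<in> P \<odot> (Q \<odot> R)"
    by (intro gprodI[of G A _ "B \<union> C"]) auto
qed

lemma gprod_assoc: "(P \<odot> Q) \<odot> R = P \<odot> (Q \<odot> R)"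
  using gprod_assoc_subset[of P Q R] gprod_assoc_subset[of R Q P] by (simp add: gprod_commute)

lemma graph_property_gprod:
  assumes P: "graph_property P" and Q: "graph_property Q"
  shows "graph_property (P \<odot> Q)"
  unfolding graph_property_def
proof (intro conjI ballI impI gprod_subset_graphs)
  fix G H assume "G \<in> P \<odot> Q" and H: "H \<in> graphs" and iso: "graph_iso G H"
  then obtain A B where G: "G \<in> graphs" and A: "A \<in> parts P G" and B: "B \<in> parts Q G"
    and AB: "A \<union> B = verts G" "A \<inter> B = {}"
    by (elim gprodE)
  obtain f where f: "embeds f G H" "f ` verts G = verts H"
    using graph_iso_imp_embeds[OF G iso] .
  show "H \<in> P \<odot> Q"
  proof (rule gprodI[OF H])
    show "f ` A \<in> parts P H" "f ` B \<in> parts Q H"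
      using A B G H P Q f by (auto simp: image_in_parts_iff parts_subset_verts)
    show "f ` A \<union> f ` B = verts H" using AB f by (simp flip: image_Un)
    show "f ` A \<inter> f ` B = {}"
      using inj_on_image_Int[OF embeds_inj_on[OF f(1)], of A B] AB by auto
  qed
qed

definition nonempty_property :: "graph set \<Rightarrow> bool" where
  "nonempty_property P \<longleftrightarrow> graph_property P \<and> P \<noteq> {}"

lemma nonempty_property_gprod:
  "nonempty_property P \<Longrightarrow> nonempty_property Q \<Longrightarrow> nonempty_property (P \<odot> Q)"
  unfolding nonempty_property_def using gprod_superset(1)[of P Q] graph_property_gprod by blast

lemma nonempty_propertyE:
  assumes "nonempty_property P"
  obtains G v where "G \<in> P" "G \<in> graphs" "v \<in> verts G"
  using assms property_in_graphs verts_nonempty unfolding nonempty_property_def by blast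

abbreviation inl :: "nat \<Rightarrow> nat" where "inl x \<equiv> sum_encode (Inl x)"
abbreviation inr :: "nat \<Rightarrow> nat" where "inr y \<equiv> sum_encode (Inr y)"

definition glue :: "(nat \<Rightarrow> nat \<Rightarrow> bool) \<Rightarrow> graph \<Rightarrow> graph \<Rightarrow> graph" where
  "glue C X Y = mkgraph (inl ` verts X \<union> inr ` verts Y)
     (\<lambda>u v. case (sum_decode u, sum_decode v) of
        (Inl x, Inl x') \<Rightarrow> adj X x x'
      | (Inr y, Inr y') \<Rightarrow> adj Y y y'
      | (Inl x, Inr y) \<Rightarrow> C x y
      | (Inr y, Inl x) \<Rightarrow> C x y)"

lemma verts_glue [simp]: "verts (glue C X Y) = inl ` verts X \<union> inr ` verts Y"
  by (simp add: glue_def)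

lemma glue_in_graphs: "X \<in> graphs \<Longrightarrow> Y \<in> graphs \<Longrightarrow> glue C X Y \<in> graphs"
  unfolding glue_def by (intro mkgraph_in_graphs) (auto simp: finite_verts verts_nonempty)

lemma card_verts_glue:
  "X \<in> graphs \<Longrightarrow> Y \<in> graphs \<Longrightarrow> card (verts (glue C X Y)) = card (verts X) + card (verts Y)"
  by (subst verts_glue, subst card_Un_disjoint)
    (auto simp: finite_verts card_image inj_on_def sum_encode_eq)

lemma adj_glue:
  "x \<in> verts X \<Longrightarrow> x' \<in> verts X \<Longrightarrow> x \<noteq> x' \<Longrightarrow> adj (glue C X Y) (inl x) (inl x') = adj X x x'"
  "y \<in> verts Y \<Longrightarrow> y' \<in> verts Y \<Longrightarrow> y \<noteq> y' \<Longrightarrow> adj (glue C X Y) (inr y) (inr y') = adj Y y y'"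
  "x \<in> verts X \<Longrightarrow> y \<in> verts Y \<Longrightarrow> adj (glue C X Y) (inl x) (inr y) = C x y"
  "x \<in> verts X \<Longrightarrow> y \<in> verts Y \<Longrightarrow> adj (glue C X Y) (inr y) (inl x) = C x y"
  by (simp_all add: glue_def adj_mkgraph sum_encode_eq adj_commute)

lemma embeds_inl: "embeds inl X (glue C X Y)"
  by (auto simp: embeds_def adj_glue inj_on_def sum_encode_eq)

lemma embeds_inr: "embeds inr Y (glue C X Y)"
  by (auto simp: embeds_def adj_glue inj_on_def sum_encode_eq)

lemma inl_image_in_parts_iff:
  "graph_property P \<Longrightarrow> X \<in> graphs \<Longrightarrow> Y \<in> graphs \<Longrightarrow> inl ` verts X \<in> parts P (glue C X Y) \<longleftrightarrow> X \<in> P"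
  using image_in_parts_iff[OF _ _ glue_in_graphs embeds_inl] by (simp add: verts_in_parts_iff)

lemma inr_image_in_parts_iff:
  "graph_property P \<Longrightarrow> X \<in> graphs \<Longrightarrow> Y \<in> graphs \<Longrightarrow> inr ` verts Y \<in> parts P (glue C X Y) \<longleftrightarrow> Y \<in> P"
  using image_in_parts_iff[OF _ _ glue_in_graphs embeds_inr] by (simp add: verts_in_parts_iff)

lemma glue_in_gprod:
  assumes "graph_property P" "graph_property Q" "X \<in> P" "Y \<in> Q"
  shows "glue C X Y \<in> P \<odot> Q"
proof (rule gprodI)
  have "X \<in> graphs" "Y \<in> graphs" using assms by (auto intro: property_in_graphs)
  then show "glue C X Y \<in> graphs" "inl ` verts X \<in> parts P (glue C X Y)"
    "inr ` verts Y \<in> parts Q (glue C X Y)"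
    using assms by (simp_all add: glue_in_graphs inl_image_in_parts_iff inr_image_in_parts_iff)
qed (auto simp: sum_encode_eq)

section \<open>Hereditary closure\<close>

definition hereditary_closure :: "graph set \<Rightarrow> graph set" where
  "hereditary_closure P = {G \<in> graphs. \<exists>H\<in>P. \<exists>f. embeds f G H}"

lemma hereditary_closureI:
  "H \<in> P \<Longrightarrow> embeds f G H \<Longrightarrow> G \<in> graphs \<Longrightarrow> G \<in> hereditary_closure P"
  unfolding hereditary_closure_def by blast

lemma hereditary_closureE:
  assumes "G \<in> hereditary_closure P"
  obtains H f where "G \<in> graphs" "H \<in> P" "embeds f G H"
  using assms unfolding hereditary_closure_def by blast

lemma hereditary_closure_mono: "P \<subseteq> Q \<Longrightarrow> hereditary_closure P \<subseteq> hereditary_closure Q"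
  by (blast intro: hereditary_closureI elim: hereditary_closureE)

lemma hereditary_closure_superset: "graph_property P \<Longrightarrow> P \<subseteq> hereditary_closure P"
  using hereditary_closureI[OF _ embeds_refl] property_in_graphs by blast

lemma graph_property_hereditary_closure: "graph_property (hereditary_closure P)"
  unfolding graph_property_def
proof (intro conjI ballI impI subsetI)
  fix G H assume "G \<in> hereditary_closure P" and H: "H \<in> graphs" and iso: "graph_iso G H"
  then obtain K f where G: "G \<in> graphs" and K: "K \<in> P" "embeds f G K"
    by (elim hereditary_closureE)
  then obtain g where "embeds g G H" "g ` verts G = verts H"
    using graph_iso_imp_embeds[OF _ iso] by blast
  then have "embeds (f \<circ> inv_into (verts G) g) H K"
    by (rule embeds_comp[OF embeds_inv_into K(2)])
  with K(1) show "H \<in> hereditary_closure P" using H by (rule hereditary_closureI)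
qed (elim hereditary_closureE)

lemma induced_hereditary_hereditary_closure: "induced_hereditary (hereditary_closure P)"
  unfolding induced_hereditary_def
proof (intro ballI allI impI)
  fix G A assume "G \<in> hereditary_closure P" and A: "A \<subseteq> verts G \<and> A \<noteq> {}"
  then obtain H f where "G \<in> graphs" "H \<in> P" "embeds f G H"
    by (elim hereditary_closureE)
  then have "embeds (f \<circ> id) (induced G A) H" "induced G A \<in> graphs"
    using A embeds_comp[OF embeds_induced_id] induced_in_graphs by blast+
  with \<open>H \<in> P\<close> show "induced G A \<in> hereditary_closure P"
    by (intro hereditary_closureI)
qed

lemma hereditary_closure_eq:
  assumes P: "graph_property P" "induced_hereditary P"
  shows "hereditary_closure P = P"
proof
  show "hereditary_closure P \<subseteq> P"
  proof
    fix G assume "G \<in> hereditary_closure P"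
    then obtain H f where G: "G \<in> graphs" and H: "H \<in> P" and f: "embeds f G H"
      by (elim hereditary_closureE)
    have gH: "H \<in> graphs" using P(1) H by (rule property_in_graphs)
    then have "f ` verts G \<in> parts P H"
      using parts_subset[OF P(2)] H embeds_image_subset[OF f] verts_in_parts_iff by blast
    then show "G \<in> P"
      using image_in_parts_iff[OF P(1) G gH f] verts_in_parts_iff[OF G] by blast
  qed
qed (rule hereditary_closure_superset[OF P(1)])

lemma parts_hereditary_closure_iff:
  assumes "P \<noteq> {}" "G \<in> graphs" "A \<subseteq> verts G"
  shows "A \<in> parts (hereditary_closure P) G \<longleftrightarrow> (\<exists>X\<in>P. \<exists>f. embeds f (induced G A) X)"
proof (cases "A = {}")
  case True
  then have "embeds f (induced G A) X" for f X by (simp add: embeds_def)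
  with True assms(1) show ?thesis by auto
next
  case False
  then have "induced G A \<in> graphs" using assms(2,3) by (intro induced_in_graphs)
  with False assms(3) show ?thesis by (simp add: parts_def hereditary_closure_def)
qed

lemma singleton_in_parts_hereditary_closure:
  assumes "nonempty_property P" "G \<in> graphs" "v \<in> verts G"
  shows "{v} \<in> parts (hereditary_closure P) G"
proof -
  obtain X w where "X \<in> P" "w \<in> verts X" using assms(1) by (rule nonempty_propertyE)
  then have "embeds (\<lambda>_. w) (induced G {v}) X" by (simp add: embeds_def)
  moreover have "P \<noteq> {}" using \<open>X \<in> P\<close> by blast
  ultimately show ?thesis
    using \<open>X \<in> P\<close> assms(2,3) parts_hereditary_closure_iff[of P G "{v}"] by blast
qed

lemma hereditary_singleton_in_parts:
  assumes "nonempty_property P" "induced_hereditary P" "G \<in> graphs" "v \<in> verts G"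
  shows "{v} \<in> parts P G"
  using assms singleton_in_parts_hereditary_closure[of P G v] hereditary_closure_eq[of P]
  by (simp add: nonempty_property_def)

lemma embeds_glue:
  assumes AB: "A \<union> B = verts G" "A \<inter> B = {}"
    and f: "embeds f (induced G A) X" and g: "embeds g (induced G B) Y"
  shows "embeds (\<lambda>v. if v \<in> A then inl (f v) else inr (g v)) G
    (glue (\<lambda>x y. adj G (inv_into A f x) (inv_into B g y)) X Y)"
    (is "embeds ?h G ?K")
  unfolding embeds_def
proof (intro conjI ballI impI)
  have inj: "inj_on f A" "inj_on g B" and im: "f ` A \<subseteq> verts X" "g ` B \<subseteq> verts Y"
    using f g by (auto simp: embeds_def)
  have B: "v \<in> B" if "v \<in> verts G" "v \<notin> A" for v using AB that by blast
  show "inj_on ?h (verts G)"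
    using inj B by (auto simp: inj_on_def sum_encode_eq)
  show "?h ` verts G \<subseteq> verts ?K"
    using im B by (auto simp: image_subset_iff)
  fix u v assume uv: "u \<in> verts G" "v \<in> verts G" "u \<noteq> v"
  then have "u \<in> A \<and> v \<in> A \<Longrightarrow> f u \<noteq> f v \<and> adj X (f u) (f v) = adj G u v"
    "u \<in> B \<and> v \<in> B \<Longrightarrow> g u \<noteq> g v \<and> adj Y (g u) (g v) = adj G u v"
    using f g by (auto simp: embeds_def inj_on_def)
  then show "adj ?K (?h u) (?h v) = adj G u v"
    using inj im uv B[of u] B[of v]
    by (auto simp: adj_glue image_subset_iff adj_commute)
qed

lemma gprod_hereditary_closure_subset:
  assumes Q: "nonempty_property Q" and R: "nonempty_property R"
  shows "hereditary_closure Q \<odot> hereditary_closure R \<subseteq> hereditary_closure (Q \<odot> R)"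
proof
  fix G assume "G \<in> hereditary_closure Q \<odot> hereditary_closure R"
  then obtain A B where G: "G \<in> graphs" and AB: "A \<union> B = verts G" "A \<inter> B = {}"
    and parts: "A \<in> parts (hereditary_closure Q) G" "B \<in> parts (hereditary_closure R) G"
    by (elim gprodE)
  then obtain X Y f g where XY: "X \<in> Q" "Y \<in> R"
    and fg: "embeds f (induced G A) X" "embeds g (induced G B) Y"
    using Q R parts_hereditary_closure_iff parts_subset_verts
    unfolding nonempty_property_def by metis
  have "glue C X Y \<in> Q \<odot> R" for C
    using Q R XY by (simp add: nonempty_property_def glue_in_gprod)
  then show "G \<in> hereditary_closure (Q \<odot> R)"
    using embeds_glue[OF AB fg] G by (rule hereditary_closureI)
qed

section \<open>Monochromatic graphs\<close>

definition monochromatic :: "bool \<Rightarrow> graph \<Rightarrow> nat set \<Rightarrow> bool" where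
  "monochromatic c G A \<longleftrightarrow> pairwise (\<lambda>u v. adj G u v = c) A"

definition mono_upto :: "bool \<Rightarrow> enat \<Rightarrow> graph set" where
  "mono_upto c s = {G \<in> graphs. monochromatic c G (verts G) \<and> enat (card (verts G)) \<le> s}"

definition mono_graph :: "bool \<Rightarrow> nat \<Rightarrow> graph" where
  "mono_graph c n = mkgraph {..<n} (\<lambda>_ _. c)"

lemma monochromaticD: "monochromatic c G A \<Longrightarrow> u \<in> A \<Longrightarrow> v \<in> A \<Longrightarrow> u \<noteq> v \<Longrightarrow> adj G u v = c"
  by (simp add: monochromatic_def pairwise_def)

lemma monochromatic_subset: "monochromatic c G A \<Longrightarrow> B \<subseteq> A \<Longrightarrow> monochromatic c G B"
  unfolding monochromatic_def by (rule pairwise_subset)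

lemma monochromatic_insert:
  "monochromatic c G (insert v A) \<longleftrightarrow> monochromatic c G A \<and> (\<forall>u\<in>A - {v}. adj G u v = c)"
  by (auto simp: monochromatic_def pairwise_insert adj_commute)

lemma monochromatic_empty [simp]: "monochromatic c G {}"
  by (simp add: monochromatic_def)

lemma monochromatic_induced [simp]: "monochromatic c (induced G A) A \<longleftrightarrow> monochromatic c G A"
  by (auto simp: monochromatic_def pairwise_def)

lemma monochromatic_image_iff:
  assumes f: "embeds f G H" and A: "A \<subseteq> verts G"
  shows "monochromatic c H (f ` A) \<longleftrightarrow> monochromatic c G A"
proof -
  have "f u \<noteq> f v \<and> adj H (f u) (f v) = adj G u v" if "u \<in> A" "v \<in> A" "u \<noteq> v" for u v
    using embeds_adj[OF f] embeds_inj_on[OF f] that A by (auto dest: inj_onD)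
  then show ?thesis
    unfolding monochromatic_def pairwise_image by (auto simp: pairwise_def)
qed

lemma monochromatic_if_card_le_1:
  assumes "finite A" "card A \<le> 1"
  shows "monochromatic c G A"
  using assms by (auto simp: monochromatic_def pairwise_def card_le_Suc0_iff_eq)

lemma card_Int_monochromatic_le_1:
  assumes "finite A" "monochromatic c G A" "monochromatic (\<not> c) G B"
  shows "card (A \<inter> B) \<le> 1"
proof -
  have "u = v" if "u \<in> A \<inter> B" "v \<in> A \<inter> B" for u v
    using assms(2,3) that monochromaticD by blast
  then show ?thesis using assms(1) by (simp add: card_le_Suc0_iff_eq)
qed

lemma parts_mono_upto:
  assumes "G \<in> graphs"
  shows "parts (mono_upto c s) G = {A. A \<subseteq> verts G \<and> monochromatic c G A \<and> enat (card A) \<le> s}"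
  using assms induced_in_graphs[OF assms]
  by (auto simp: parts_def mono_upto_def zero_enat_def[symmetric])

lemma mono_upto_subset_unbounded: "mono_upto c s \<subseteq> mono_upto c \<infinity>"
  by (auto simp: mono_upto_def)

lemma edgeless_upto_eq_mono_upto: "edgeless_upto s = mono_upto False s"
proof -
  have "edges G = {} \<longleftrightarrow> monochromatic False G (verts G)" if "G \<in> graphs" for G
    using edges_conv_adj[OF that] by (auto simp: monochromatic_def pairwise_def)
  then show ?thesis by (auto simp: edgeless_upto_def mono_upto_def)
qed

lemma complete_upto_eq_mono_upto: "complete_upto s = mono_upto True s"
proof -
  have "edges G = {e. e \<subseteq> verts G \<and> card e = 2} \<longleftrightarrow> monochromatic True G (verts G)"
    if "G \<in> graphs" for G
  proof
    assume "edges G = {e. e \<subseteq> verts G \<and> card e = 2}"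
    then show "monochromatic True G (verts G)"
      by (simp add: monochromatic_def pairwise_def adj_def)
  next
    assume "monochromatic True G (verts G)"
    then have "e \<in> edges G" if "e \<subseteq> verts G" "card e = 2" for e
      using that by (auto simp: card_2_iff monochromatic_def pairwise_def adj_def)
    then show "edges G = {e. e \<subseteq> verts G \<and> card e = 2}"
      using \<open>G \<in> graphs\<close> by (auto simp: graphs_def)
  qed
  then show ?thesis by (auto simp: complete_upto_def mono_upto_def)
qed

lemma hereditary_closure_mono_upto: "hereditary_closure (mono_upto c s) = mono_upto c s"
proof
  show "hereditary_closure (mono_upto c s) \<subseteq> mono_upto c s"
  proof
    fix G assume "G \<in> hereditary_closure (mono_upto c s)"
    then obtain H f where G: "G \<in> graphs" and H: "H \<in> mono_upto c s" and f: "embeds f G H"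
      by (elim hereditary_closureE)
    have "monochromatic c H (f ` verts G)"
      using H embeds_image_subset[OF f] by (auto simp: mono_upto_def intro: monochromatic_subset)
    then have "monochromatic c G (verts G)" by (simp add: monochromatic_image_iff[OF f])
    moreover have "card (verts G) \<le> card (verts H)"
      using H f by (intro card_inj_on_le[of f]) (auto simp: embeds_def mono_upto_def finite_verts)
    then have "enat (card (verts G)) \<le> s"
      using H by (auto simp: mono_upto_def intro: order_trans[rotated])
    ultimately show "G \<in> mono_upto c s" using G by (simp add: mono_upto_def)
  qed
  show "mono_upto c s \<subseteq> hereditary_closure (mono_upto c s)"
    by (auto simp: mono_upto_def intro: hereditary_closureI[OF _ embeds_refl])
qed

lemma graph_property_mono_upto: "graph_property (mono_upto c s)"
  using graph_property_hereditary_closure[of "mono_upto c s"]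
  by (simp add: hereditary_closure_mono_upto)

lemma induced_hereditary_mono_upto: "induced_hereditary (mono_upto c s)"
  using induced_hereditary_hereditary_closure[of "mono_upto c s"]
  by (simp add: hereditary_closure_mono_upto)

lemma verts_mono_graph [simp]: "verts (mono_graph c n) = {..<n}"
  by (simp add: mono_graph_def)

lemma mono_graph_in_graphs: "1 \<le> n \<Longrightarrow> mono_graph c n \<in> graphs"
  unfolding mono_graph_def by (intro mkgraph_in_graphs) (auto simp: lessThan_empty_iff)

lemma mono_graph_in_mono_upto: "1 \<le> n \<Longrightarrow> enat n \<le> s \<Longrightarrow> mono_graph c n \<in> mono_upto c s"
  using mono_graph_in_graphs[of n c]
  by (simp add: mono_upto_def monochromatic_def pairwise_def mono_graph_def adj_mkgraph)

lemma nonempty_property_mono_upto: "1 \<le> s \<Longrightarrow> nonempty_property (mono_upto c s)"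
  using mono_graph_in_mono_upto[of 1 s c] graph_property_mono_upto
  by (auto simp: nonempty_property_def one_enat_def)

lemma mono_upto_1: "mono_upto c 1 = mono_upto d 1"
proof -
  have "monochromatic e G (verts G)" if "G \<in> graphs" "card (verts G) \<le> 1" for e G
    using that finite_verts by (intro monochromatic_if_card_le_1)
  then show ?thesis by (auto simp: mono_upto_def one_enat_def)
qed

lemma monochromatic_embeds:
  assumes "finite (verts G)" "finite (verts H)" "card (verts G) \<le> card (verts H)"
    and "monochromatic c G (verts G)" "monochromatic c H (verts H)"
  shows "\<exists>f. embeds f G H"
proof -
  obtain f where im: "f ` verts G \<subseteq> verts H" and inj: "inj_on f (verts G)"
    using card_le_inj[of "verts G" "verts H"] assms by blast
  have "adj H (f u) (f v) = adj G u v" if "u \<in> verts G" "v \<in> verts G" "u \<noteq> v" for u v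
  proof -
    have "f u \<noteq> f v" "f u \<in> verts H" "f v \<in> verts H" using inj im that by (auto dest: inj_onD)
    then show ?thesis using assms(4,5) that by (simp add: monochromaticD)
  qed
  with inj im have "embeds f G H" by (simp add: embeds_def)
  then show ?thesis by blast
qed

lemma monochromatic_mem_iff:
  assumes P: "graph_property P" and G: "G \<in> graphs" and H: "H \<in> graphs"
    and mono: "monochromatic c G (verts G)" "monochromatic c H (verts H)"
    and card: "card (verts G) = card (verts H)"
  shows "G \<in> P \<longleftrightarrow> H \<in> P"
proof -
  obtain f where f: "embeds f G H"
    using monochromatic_embeds[of G H c] G H mono card by (auto simp: finite_verts)
  have "f ` verts G = verts H"
    using f H card by (intro card_subset_eq) (auto simp: embeds_def finite_verts card_image)
  with P G H f show ?thesis by (intro property_embeds_onto_iff)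
qed

lemma hereditary_subset_mono_uptoE:
  assumes P: "nonempty_property P" "induced_hereditary P" and mono: "P \<subseteq> mono_upto c \<infinity>"
  obtains s where "1 \<le> s" "P = mono_upto c s"
proof
  define s where "s = (SUP G\<in>P. enat (card (verts G)))"
  have upper: "enat (card (verts G)) \<le> s" if "G \<in> P" for G
    unfolding s_def using that by (rule SUP_upper)
  obtain X where "X \<in> P" "X \<in> graphs" using P(1) by (rule nonempty_propertyE)
  then show "1 \<le> s"
    using card_verts_pos[of X] upper[of X] by (auto simp: one_enat_def intro: order_trans[rotated])
  show "P = mono_upto c s"
  proof
    show "P \<subseteq> mono_upto c s" using mono upper by (auto simp: mono_upto_def)
    show "mono_upto c s \<subseteq> P"
    proof
      fix G assume G: "G \<in> mono_upto c s"
      then have gG: "G \<in> graphs" by (simp add: mono_upto_def)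
      have "enat (card (verts G) - 1) < enat (card (verts G))" using card_verts_pos[OF gG] by simp
      also have "\<dots> \<le> s" using G by (simp add: mono_upto_def)
      finally obtain H where H: "H \<in> P" "card (verts G) - 1 < card (verts H)"
        unfolding s_def by (auto simp: less_SUP_iff)
      have "card (verts G) \<le> card (verts H)" using H(2) by linarith
      moreover have "H \<in> graphs" "monochromatic c H (verts H)"
        using H(1) mono by (auto simp: mono_upto_def)
      ultimately obtain f where "embeds f G H"
        using monochromatic_embeds[of G H c] G
        by (auto simp: mono_upto_def finite_verts)
      then have "G \<in> hereditary_closure P" using H(1) gG by (intro hereditary_closureI)
      then show "G \<in> P" using hereditary_closure_eq P by (simp add: nonempty_property_def)
    qed
  qed
qed

section \<open>Factorisations\<close>

definition splits :: "graph set list \<Rightarrow> graph \<Rightarrow> nat set \<Rightarrow> (nat \<Rightarrow> nat set) \<Rightarrow> bool" where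
  "splits Ps G B A \<longleftrightarrow> (\<Union>i<length Ps. A i) = B \<and> disjoint_family_on A {..<length Ps} \<and>
     (\<forall>i<length Ps. A i \<in> parts (Ps ! i) G)"

lemma splits_Cons:
  "splits (P # Ps) G B A \<longleftrightarrow> A 0 \<in> parts P G \<and> A 0 \<subseteq> B \<and> splits Ps G (B - A 0) (A \<circ> Suc)"
proof -
  let ?C = "\<Union>i<length Ps. A (Suc i)"
  have union: "(\<Union>i<Suc (length Ps). A i) = A 0 \<union> ?C"
    by (simp add: lessThan_Suc_eq_insert_0)
  have disjoint: "disjoint_family_on A {..<Suc (length Ps)} \<longleftrightarrow>
      A 0 \<inter> ?C = {} \<and> disjoint_family_on (\<lambda>i. A (Suc i)) {..<length Ps}"
    unfolding lessThan_Suc_eq_insert_0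
    by (subst disjoint_family_on_insert) (auto simp: disjoint_family_on_def)
  have members: "(\<forall>i<Suc (length Ps). A i \<in> parts ((P # Ps) ! i) G) \<longleftrightarrow>
      A 0 \<in> parts P G \<and> (\<forall>i<length Ps. A (Suc i) \<in> parts (Ps ! i) G)"
    by (auto simp: less_Suc_eq_0_disj)
  have "A 0 \<union> ?C = B \<and> A 0 \<inter> ?C = {} \<longleftrightarrow> A 0 \<subseteq> B \<and> ?C = B - A 0"
    by blast
  then show ?thesis
    unfolding splits_def length_Cons comp_apply union disjoint members comp_def by argo
qed

lemma splits_subset_verts: "splits Ps G B A \<Longrightarrow> B \<subseteq> verts G"
  by (auto simp: splits_def dest: parts_subset_verts)

lemma splits_induced:
  assumes "B \<subseteq> verts G"
  shows "splits Ps (induced G B) B A \<longleftrightarrow> splits Ps G B A"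
proof -
  have "A i \<in> parts (Ps ! i) (induced G B) \<longleftrightarrow> A i \<in> parts (Ps ! i) G"
    if "(\<Union>i<length Ps. A i) = B" "i < length Ps" for i
    using assms that by (subst parts_induced) auto
  then show ?thesis unfolding splits_def by blast
qed

lemma gprods_iff: "G \<in> gprods Ps \<longleftrightarrow> G \<in> graphs \<and> (\<exists>A. splits Ps G (verts G) A)"
proof -
  have "splits Ps G (verts G) A \<longleftrightarrow> (\<Union>i<length Ps. A i) = verts G \<and>
      disjoint_family_on A {..<length Ps} \<and> (\<forall>i<length Ps. A i = {} \<or> induced G (A i) \<in> Ps ! i)"
    for A
    by (auto simp: splits_def parts_def)
  then show ?thesis by (simp add: gprods_def)
qed

lemma parts_gprods_iff:
  assumes "G \<in> graphs"
  shows "B \<in> parts (gprods Ps) G \<longleftrightarrow> (\<exists>A. splits Ps G B A)"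
proof (cases "B \<subseteq> verts G \<and> B \<noteq> {}")
  case True
  then have "B \<in> parts (gprods Ps) G \<longleftrightarrow> (\<exists>A. splits Ps (induced G B) B A)"
    using assms by (simp add: parts_def gprods_iff induced_in_graphs)
  with True show ?thesis by (simp add: splits_induced)
next
  case False
  moreover have "splits Ps G {} (\<lambda>_. {})"
    by (simp add: splits_def disjoint_family_on_def)
  ultimately show ?thesis
    using empty_in_parts parts_subset_verts[of B] splits_subset_verts[of Ps G B] by metis
qed

lemma gprods_Cons: "gprods (P # Ps) = P \<odot> gprods Ps"
proof (rule set_eqI)
  fix G
  have "(\<exists>A. splits (P # Ps) G (verts G) A) \<longleftrightarrow> (\<exists>B\<in>parts P G. \<exists>A. splits Ps G (verts G - B) A)"
    (is "?L \<longleftrightarrow> ?R")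
  proof
    assume ?R
    then obtain B A where "B \<in> parts P G" "splits Ps G (verts G - B) A" by blast
    then have "splits (P # Ps) G (verts G) (case_nat B A)"
      by (auto simp: splits_Cons comp_def dest: parts_subset_verts)
    then show ?L by blast
  qed (auto simp: splits_Cons)
  then show "G \<in> gprods (P # Ps) \<longleftrightarrow> G \<in> P \<odot> gprods Ps"
    by (simp add: gprods_iff gprod_iff parts_gprods_iff cong: conj_cong)
qed

lemma gprods_Nil: "gprods [] = {}"
  by (auto simp: gprods_def graphs_def)

lemma graph_property_gprods: "(\<And>P. P \<in> set Ps \<Longrightarrow> graph_property P) \<Longrightarrow> graph_property (gprods Ps)"
  by (induction Ps) (auto simp: gprods_Nil gprods_Cons graph_property_gprod
      graph_property_def[of "{}"])

lemma nonempty_property_gprods: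
  assumes "Ps \<noteq> []" "\<And>P. P \<in> set Ps \<Longrightarrow> nonempty_property P"
  shows "nonempty_property (gprods Ps)"
proof -
  obtain P Qs where Ps: "Ps = P # Qs" using assms(1) by (cases Ps) auto
  then have "P \<subseteq> gprods Ps"
    using assms(2) gprod_superset(1) by (simp add: gprods_Cons nonempty_property_def)
  then show ?thesis
    using assms(2) graph_property_gprods[of Ps] Ps by (auto simp: nonempty_property_def)
qed

lemma gprods_singleton: "graph_property P \<Longrightarrow> gprods [P] = P"
  by (simp add: gprods_Cons gprods_Nil gprod_empty)

lemma gprods_append:
  assumes "\<And>Q. Q \<in> set Qs \<Longrightarrow> graph_property Q"
  shows "gprods (Ps @ Qs) = gprods Ps \<odot> gprods Qs"
proof (induction Ps)
  case Nil
  have "{} \<odot> gprods Qs = gprods Qs"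
    using assms by (simp add: gprod_commute[of "{}"] gprod_empty graph_property_gprods)
  then show ?case by (simp add: gprods_Nil)
qed (simp add: gprods_Cons gprod_assoc)

lemma gprods_cong_mset:
  assumes "mset Ps = mset Qs"
  shows "gprods Ps = gprods Qs"
proof -
  have left_commute: "P \<odot> (Q \<odot> R) = Q \<odot> (P \<odot> R)" for P Q R
    using gprod_assoc[of P Q R] gprod_assoc[of Q P R] gprod_commute[of P Q] by simp
  interpret comp_fun_commute "(\<odot>)"
    by (unfold_locales, intro ext, unfold comp_apply, rule left_commute)
  have "gprods Rs = fold_mset (\<odot>) {} (mset Rs)" for Rs
    by (induction Rs) (simp_all add: gprods_Nil gprods_Cons)
  with assms show ?thesis by simp
qed

lemma factorisation_property: "factorisation Ps P \<Longrightarrow> Q \<in> set Ps \<Longrightarrow> graph_property Q"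
  by (auto simp: factorisation_def irreducible_property_def)

lemma factorisation_singleton: "irreducible_property P \<Longrightarrow> factorisation [P] P"
  by (simp add: factorisation_def gprods_singleton irreducible_property_def)

lemma factorisation_singletonD:
  assumes "factorisation [Q] P"
  shows "Q = P"
  using assms gprods_singleton[of Q] by (simp add: factorisation_def irreducible_property_def)

lemma factorisation_nonempty:
  assumes Ps: "factorisation Ps P" and "P \<noteq> {}" and "Q \<in> set Ps"
  shows "nonempty_property Q"
proof (cases "length Ps > 1")
  case True
  then show ?thesis
    using assms factorisation_property by (auto simp: factorisation_def nonempty_property_def)
next
  case False
  then have "Ps = [Q]" using assms(3) by (cases Ps) auto
  then show ?thesis
    using assms factorisation_singletonD factorisation_property
    by (auto simp: nonempty_property_def)
qed

lemma factorisation_append: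
  assumes P: "factorisation Ps P" "P \<noteq> {}" and Q: "factorisation Qs Q" "Q \<noteq> {}"
  shows "factorisation (Ps @ Qs) (P \<odot> Q)"
proof -
  have "{} \<notin> set (Ps @ Qs)"
    using factorisation_nonempty[OF P] factorisation_nonempty[OF Q]
    by (auto simp: nonempty_property_def)
  then show ?thesis
    using P Q gprods_append[of Qs Ps] factorisation_property[OF Q(1)]
    by (auto simp: factorisation_def)
qed

lemma factorisation_cases [consumes 1, case_names irreducible reducible]:
  assumes "factorisation Ps P"
  obtains "Ps = [P]" "irreducible_property P"
  | Q Qs where "Ps = Q # Qs" "P = Q \<odot> gprods Qs" "nonempty_property Q"
    "nonempty_property (gprods Qs)" "factorisation Qs (gprods Qs)"
proof -
  obtain Q Qs where Ps: "Ps = Q # Qs" using assms by (cases Ps) (auto simp: factorisation_def)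
  show ?thesis
  proof (cases "Qs = []")
    case True
    then have "Q = P" using assms Ps factorisation_singletonD by simp
    then show ?thesis using that(1) True Ps assms by (simp add: factorisation_def)
  next
    case False
    then have proper: "nonempty_property R" if "R \<in> set Ps" for R
      using assms Ps that factorisation_property[OF assms]
      by (auto simp: factorisation_def nonempty_property_def)
    show ?thesis
    proof (rule that(2)[OF Ps])
      show "P = Q \<odot> gprods Qs" using assms Ps by (simp add: factorisation_def gprods_Cons)
      show "nonempty_property Q" using proper Ps by simp
      show "nonempty_property (gprods Qs)"
        using False proper Ps by (intro nonempty_property_gprods) auto
      show "factorisation Qs (gprods Qs)"
        using False assms Ps by (auto simp: factorisation_def)
    qed
  qed
qed

lemma reducibleE:
  assumes "graph_property P" "\<not> irreducible_property P"
  obtains Q R where "nonempty_property Q" "nonempty_property R" "P = Q \<odot> R"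
proof -
  obtain Q R where QR: "graph_property Q" "graph_property R" "Q \<noteq> P" "R \<noteq> P" "P = Q \<odot> R"
    using assms by (auto simp: irreducible_property_def reducible_property_def)
  moreover have "Q \<noteq> {}" "R \<noteq> {}"
    using QR gprod_empty gprod_commute by metis+
  ultimately show ?thesis using that by (simp add: nonempty_property_def)
qed

definition universal :: "nat \<Rightarrow> graph set \<Rightarrow> bool" where
  "universal k P \<longleftrightarrow> {G \<in> graphs. card (verts G) = k} \<subseteq> hereditary_closure P"

lemma universal_mono: "P \<subseteq> Q \<Longrightarrow> universal k P \<Longrightarrow> universal k Q"
  unfolding universal_def using hereditary_closure_mono by blast

lemma universal_0: "universal 0 P"
  using card_verts_pos by (force simp: universal_def)

lemma universal_Suc:
  assumes Q: "nonempty_property Q" and R: "nonempty_property R" and k: "universal k Q"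
  shows "universal (Suc k) (Q \<odot> R)"
  unfolding universal_def
proof
  fix G assume "G \<in> {G \<in> graphs. card (verts G) = Suc k}"
  then have G: "G \<in> graphs" and card: "card (verts G) = Suc k" by auto
  obtain v where v: "v \<in> verts G" using verts_nonempty[OF G] by blast
  have "card (verts G - {v}) = k" using card v by simp
  then have "induced G (verts G - {v}) \<in> hereditary_closure Q" if "verts G - {v} \<noteq> {}"
    using k G that induced_in_graphs[of G "verts G - {v}"] by (auto simp: universal_def)
  then have "verts G - {v} \<in> parts (hereditary_closure Q) G"
    unfolding parts_def by blast
  moreover have "{v} \<in> parts (hereditary_closure R) G"
    using R G v by (rule singleton_in_parts_hereditary_closure)
  ultimately have "G \<in> hereditary_closure Q \<odot> hereditary_closure R"
    using G v by (intro gprodI) auto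
  then show "G \<in> hereditary_closure (Q \<odot> R)"
    using gprod_hereditary_closure_subset[OF Q R] by blast
qed

lemma hereditary_universal_imp_graphs:
  assumes "graph_property P" "induced_hereditary P" "\<And>k. universal k P"
  shows "P = graphs"
  using assms hereditary_closure_eq[OF assms(1,2)] property_in_graphs by (auto simp: universal_def)

lemma absorbing_imp_graphs:
  assumes P: "nonempty_property P" "induced_hereditary P" and R: "nonempty_property R"
    and absorbs: "P \<odot> R = P"
  shows "P = graphs"
proof (rule hereditary_universal_imp_graphs)
  show "universal k P" for k
  proof (induction k)
    case (Suc k)
    then show ?case using universal_Suc[OF P(1) R] absorbs by simp
  qed (rule universal_0)
qed (use P in \<open>auto simp: nonempty_property_def\<close>)

text \<open>Each splitting of a property strictly lowers the least \<open>k\<close> for which it is not universal.\<close>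

lemma factorisation_exists:
  assumes "nonempty_property P" "\<not> universal k P"
  shows "\<exists>Ps. factorisation Ps P"
  using assms
proof (induction k arbitrary: P)
  case 0
  then show ?case using universal_0 by blast
next
  case (Suc k)
  show ?case
  proof (cases "irreducible_property P")
    case True
    then show ?thesis using factorisation_singleton by blast
  next
    case False
    then obtain Q R where QR: "nonempty_property Q" "nonempty_property R" and P: "P = Q \<odot> R"
      using reducibleE Suc.prems(1) by (auto simp: nonempty_property_def)
    then have "\<not> universal k Q" "\<not> universal k R"
      using universal_Suc[of Q R k] universal_Suc[of R Q k] Suc.prems(2) gprod_commute[of Q R]
      by auto
    then obtain Qs Rs where "factorisation Qs Q" "factorisation Rs R"
      using Suc.IH QR by blast
    then show ?thesis
      using factorisation_append QR P unfolding nonempty_property_def by blast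
  qed
qed

section \<open>Irreducible properties and cancellation\<close>

lemma graph_property_card_filter:
  assumes "graph_property P"
  shows "graph_property {G \<in> P. F (card (verts G))}"
proof -
  have "card (verts H) = card (verts G)" if "graph_iso G H" for G H
    using that bij_betw_same_card unfolding graph_iso_def by metis
  then show ?thesis using assms unfolding graph_property_def by auto
qed

lemma reducible_graphs: "reducible_property graphs"
proof -
  let ?one = "{G \<in> graphs. card (verts G) = 1}" and ?other = "{G \<in> graphs. card (verts G) \<noteq> 1}"
  have "graph_property graphs" by (simp add: graph_property_def)
  then have props: "graph_property ?one" "graph_property ?other"
    using graph_property_card_filter[of graphs "\<lambda>n. n = 1"]
      graph_property_card_filter[of graphs "\<lambda>n. n \<noteq> 1"] by simp_all
  have "mono_graph True 1 \<in> graphs - ?other" "mono_graph True 2 \<in> graphs - ?one"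
    by (simp_all add: mono_graph_in_graphs)
  then have "?one \<noteq> graphs" "?other \<noteq> graphs" by blast+
  moreover have "graphs = ?one \<union> ?other" by blast
  then have "graphs = ?one \<odot> ?other"
    using gprod_superset(1)[OF props(1)] gprod_superset(2)[OF props(2)] gprod_subset_graphs by blast
  ultimately show ?thesis using props unfolding reducible_property_def by blast
qed

lemma not_unique_factorisation_graphs: "\<not> unique_factorisation graphs"
proof
  assume uniq: "unique_factorisation graphs"
  then obtain P Ps where Ps: "factorisation (P # Ps) graphs"
    unfolding unique_factorisation_def factorisation_def by (metis list.exhaust)
  have ne: "graphs \<noteq> {}" using mono_graph_in_graphs[of 1] by blast
  have P: "irreducible_property P" "P \<noteq> {}"
    using Ps factorisation_nonempty[OF Ps ne, of P]
    by (simp_all add: factorisation_def nonempty_property_def)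
  have "graphs \<odot> P = graphs"
    using gprod_superset(1)[of graphs P] gprod_subset_graphs by (auto simp: graph_property_def)
  then have "factorisation ((P # Ps) @ [P]) graphs"
    using factorisation_append[OF Ps ne factorisation_singleton[OF P(1)] P(2)] by simp
  then have "mset ((P # Ps) @ [P]) = mset (P # Ps)"
    using Ps uniq unfolding unique_factorisation_def by metis
  then show False by simp
qed

lemma irreducible_neq_gprod:
  assumes M: "irreducible_property M" "induced_hereditary M"
    and Q: "nonempty_property Q" and R: "nonempty_property R"
  shows "M \<noteq> Q \<odot> R"
proof
  assume eq: "M = Q \<odot> R"
  then have M_ne: "nonempty_property M" using Q R by (simp add: nonempty_property_gprod)
  have "Q = M \<or> R = M"
    using M(1) eq Q R
    unfolding irreducible_property_def reducible_property_def nonempty_property_def by blast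
  then have "M \<odot> R = M \<or> M \<odot> Q = M" using eq gprod_commute by metis
  then have "M = graphs" using absorbing_imp_graphs[OF M_ne M(2)] Q R by blast
  then show False using M(1) reducible_graphs by (simp add: irreducible_property_def)
qed

lemma factorisation_irreducible:
  assumes "irreducible_property P" "induced_hereditary P" "factorisation Ps P"
  shows "Ps = [P]"
  using assms(3)
proof (cases rule: factorisation_cases)
  case (reducible Q Qs)
  then show ?thesis using irreducible_neq_gprod[OF assms(1,2)] by blast
qed

lemma irreducible_imp_unique_factorisation:
  assumes "irreducible_property P" "induced_hereditary P"
  shows "unique_factorisation P"
  using assms factorisation_singleton factorisation_irreducible
  unfolding unique_factorisation_def by metis

definition cancellable :: "graph set \<Rightarrow> graph set \<Rightarrow> bool" where
  "cancellable Q R \<longleftrightarrow> (\<forall>Q'. nonempty_property Q' \<longrightarrow> Q' \<odot> R = Q \<odot> R \<longrightarrow> Q' = Q)"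

lemma unique_factorisation_imp_cancellable:
  assumes Q: "nonempty_property Q" and R: "nonempty_property R"
    and her: "induced_hereditary (Q \<odot> R)" and uniq: "unique_factorisation (Q \<odot> R)"
  shows "cancellable Q R"
  unfolding cancellable_def
proof (intro allI impI)
  fix Q' assume Q': "nonempty_property Q'" and eq: "Q' \<odot> R = Q \<odot> R"
  have "Q \<odot> R \<noteq> graphs" using uniq not_unique_factorisation_graphs by auto
  then obtain k where k: "\<not> universal k (Q \<odot> R)"
    using hereditary_universal_imp_graphs her nonempty_property_gprod[OF Q R]
    by (auto simp: nonempty_property_def)
  have "\<exists>Ss. factorisation Ss S" if "nonempty_property S" "S \<subseteq> Q \<odot> R" for S
    using factorisation_exists[OF that(1)] universal_mono[OF that(2)] k by blast
  moreover have "Q \<subseteq> Q \<odot> R" "Q' \<subseteq> Q \<odot> R" "R \<subseteq> Q \<odot> R"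
    using gprod_superset Q Q' R eq unfolding nonempty_property_def by metis+
  ultimately obtain Qs Qs' Rs where
    Qs: "factorisation Qs Q" and Qs': "factorisation Qs' Q'" and Rs: "factorisation Rs R"
    using Q Q' R by metis
  have "factorisation (Qs @ Rs) (Q \<odot> R)" "factorisation (Qs' @ Rs) (Q' \<odot> R)"
    using Q Q' R by (auto simp: nonempty_property_def intro: factorisation_append Qs Qs' Rs)
  then have "mset (Qs @ Rs) = mset (Qs' @ Rs)"
    using uniq unfolding unique_factorisation_def eq by metis
  then have "gprods Qs = gprods Qs'" by (intro gprods_cong_mset) simp
  then show "Q' = Q" using Qs Qs' by (simp add: factorisation_def)
qed

lemma cancellable_imp_hereditary:
  assumes Q: "nonempty_property Q" and R: "nonempty_property R"
    and her: "induced_hereditary (Q \<odot> R)" and cancel: "cancellable Q R"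
  shows "induced_hereditary Q"
proof -
  let ?cl = hereditary_closure
  have props: "graph_property Q" "graph_property R" "graph_property (Q \<odot> R)"
    using Q R nonempty_property_gprod[OF Q R] by (auto simp: nonempty_property_def)
  have "?cl Q \<odot> R \<subseteq> ?cl Q \<odot> ?cl R"
    by (intro gprod_mono hereditary_closure_superset props) simp
  also have "\<dots> \<subseteq> ?cl (Q \<odot> R)" using Q R by (rule gprod_hereditary_closure_subset)
  also have "\<dots> = Q \<odot> R" using props(3) her by (rule hereditary_closure_eq)
  finally have "?cl Q \<odot> R = Q \<odot> R"
    using gprod_mono[OF hereditary_closure_superset[OF props(1)], of R R] by auto
  moreover have "nonempty_property (?cl Q)"
    using hereditary_closure_superset[OF props(1)] Q graph_property_hereditary_closure
    by (auto simp: nonempty_property_def)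
  ultimately have "?cl Q = Q" using cancel by (simp add: cancellable_def)
  then show ?thesis using induced_hereditary_hereditary_closure[of Q] by simp
qed

lemma gprod_without_singletons:
  assumes R: "nonempty_property R" "induced_hereditary R"
    and extend: "\<And>G v. G \<in> graphs \<Longrightarrow> v \<in> verts G \<Longrightarrow> verts G \<noteq> {v} \<Longrightarrow> verts G - {v} \<in> parts R G \<Longrightarrow>
      G \<notin> R \<Longrightarrow> \<exists>u\<in>verts G - {v}. {u, v} \<in> parts Q G"
  shows "{G \<in> Q. card (verts G) \<noteq> 1} \<odot> R = Q \<odot> R" (is "?Q' \<odot> R = _")
proof
  show "?Q' \<odot> R \<subseteq> Q \<odot> R" by (intro gprod_mono) auto
  show "Q \<odot> R \<subseteq> ?Q' \<odot> R"
  proof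
    fix G assume "G \<in> Q \<odot> R"
    then obtain A where G: "G \<in> graphs" and A: "A \<in> parts Q G" and B: "verts G - A \<in> parts R G"
      by (auto simp: gprod_iff)
    have parts_Q': "C \<in> parts ?Q' G" if "C \<in> parts Q G" "card C \<noteq> 1" for C
      using that by (auto simp: parts_def)
    consider (large) "card A \<noteq> 1" | (mem) "G \<in> R" | (single) v where "A = {v}" "G \<notin> R"
      by (auto simp: card_1_singleton_iff)
    then show "G \<in> ?Q' \<odot> R"
    proof cases
      case large
      then show ?thesis using G A B parts_Q' gprod_iff by blast
    next
      case mem
      then show ?thesis using gprod_superset(2) R(1) by (auto simp: nonempty_property_def)
    next
      case single
      then have v: "v \<in> verts G" using A by (auto dest: parts_subset_verts)
      then have "verts G \<noteq> {v}"
        using single(2) hereditary_singleton_in_parts[OF R G v] verts_in_parts_iff[OF G, of R]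
        by auto
      then obtain u where u: "u \<in> verts G - {v}" "{u, v} \<in> parts Q G"
        using extend[OF G v] B single by blast
      moreover have "verts G - {u, v} \<in> parts R G"
        using parts_subset[OF R(2) B] single(1) by blast
      ultimately show ?thesis
        using G parts_Q'[of "{u, v}"] by (auto simp: gprod_iff)
    qed
  qed
qed

lemma not_cancellableI:
  assumes Q: "graph_property Q" "induced_hereditary Q" and X: "X \<in> Q" "card (verts X) \<noteq> 1"
    and R: "nonempty_property R" "induced_hereditary R"
    and extend: "\<And>G v. G \<in> graphs \<Longrightarrow> v \<in> verts G \<Longrightarrow> verts G \<noteq> {v} \<Longrightarrow> verts G - {v} \<in> parts R G \<Longrightarrow>
      G \<notin> R \<Longrightarrow> \<exists>u\<in>verts G - {v}. {u, v} \<in> parts Q G"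
  shows "\<not> cancellable Q R"
proof
  assume cancel: "cancellable Q R"
  let ?Q' = "{G \<in> Q. card (verts G) \<noteq> 1}"
  have "nonempty_property ?Q'"
    unfolding nonempty_property_def
    using X graph_property_card_filter[OF Q(1), of "\<lambda>n. n \<noteq> 1"] by blast
  moreover have "?Q' \<odot> R = Q \<odot> R" using R extend by (rule gprod_without_singletons)
  ultimately have "?Q' = Q" using cancel unfolding cancellable_def by blast
  moreover obtain x where "x \<in> verts X"
    using X(1) Q(1) property_in_graphs verts_nonempty by blast
  then have "induced X {x} \<in> Q" using X(1) Q(2) unfolding induced_hereditary_def by auto
  moreover have "induced X {x} \<notin> ?Q'" by simp
  ultimately show False by blast
qed

section \<open>Cancellable factors are monochromatic\<close>

lemma hereditary_pair_in_parts:
  assumes P: "graph_property P" "induced_hereditary P"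
    and X: "X \<in> P" "x \<in> verts X" "y \<in> verts X" "x \<noteq> y"
    and G: "G \<in> graphs" "u \<in> verts G" "v \<in> verts G" "u \<noteq> v" and adj: "adj X x y = adj G u v"
  shows "{u, v} \<in> parts P G"
proof -
  have "embeds (\<lambda>w. if w = u then x else y) (induced G {u, v}) X"
    using X G(4) adj
    by (auto simp: embeds_def inj_on_def adj_commute[of X y x] adj_commute[of G v u])
  then have "induced G {u, v} \<in> hereditary_closure P"
    using G by (intro hereditary_closureI[OF X(1)] induced_in_graphs) auto
  then show ?thesis using G hereditary_closure_eq[OF P] by (simp add: parts_def)
qed

lemma cancellable_imp_mono_upto:
  assumes Q: "nonempty_property Q" "induced_hereditary Q"
    and R: "nonempty_property R" "induced_hereditary R" and cancel: "cancellable Q R"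
  obtains c s where "1 \<le> s" "Q = mono_upto c s"
proof (cases "\<exists>c. Q \<subseteq> mono_upto c \<infinity>")
  case True
  then show ?thesis using that hereditary_subset_mono_uptoE[OF Q] by blast
next
  case False
  have gQ: "graph_property Q" using Q(1) by (simp add: nonempty_property_def)
  have both_colours: "\<exists>X\<in>Q. \<exists>x\<in>verts X. \<exists>y\<in>verts X. x \<noteq> y \<and> adj X x y = c" for c
  proof -
    have "\<not> Q \<subseteq> mono_upto (\<not> c) \<infinity>" using False by blast
    then obtain X where "X \<in> Q" "\<not> monochromatic (\<not> c) X (verts X)"
      using property_in_graphs[OF gQ] by (auto simp: mono_upto_def)
    then show ?thesis by (auto simp: monochromatic_def pairwise_def)
  qed
  have pairs: "{u, v} \<in> parts Q G" if "G \<in> graphs" "u \<in> verts G" "v \<in> verts G" "u \<noteq> v" for G u v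
    using both_colours[of "adj G u v"] hereditary_pair_in_parts[OF gQ Q(2)] that by blast
  obtain X x y where X: "X \<in> Q" "x \<in> verts X" "y \<in> verts X" "x \<noteq> y" using both_colours by blast
  then have "card (verts X) \<noteq> 1" by (auto simp: card_1_singleton_iff)
  then have "\<not> cancellable Q R"
    using pairs by (intro not_cancellableI[OF gQ Q(2) X(1) _ R]) blast+
  then show ?thesis using cancel by blast
qed

lemma not_cancellable_opposite:
  assumes "2 \<le> r"
  shows "\<not> cancellable (mono_upto c r) (mono_upto (\<not> c) \<infinity>)"
proof (rule not_cancellableI)
  show "mono_graph c 2 \<in> mono_upto c r" "card (verts (mono_graph c 2)) \<noteq> 1"
    using assms by (auto simp: numeral_eq_enat intro: mono_graph_in_mono_upto)
  fix G v assume G: "G \<in> graphs" and v: "v \<in> verts G"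
    and rest: "verts G - {v} \<in> parts (mono_upto (\<not> c) \<infinity>) G" and not: "G \<notin> mono_upto (\<not> c) \<infinity>"
  have "\<not> monochromatic (\<not> c) G (insert v (verts G - {v}))"
    using not G v by (simp add: mono_upto_def insert_absorb)
  moreover have "monochromatic (\<not> c) G (verts G - {v})"
    using rest G by (simp add: parts_mono_upto)
  ultimately obtain u where u: "u \<in> verts G - {v}" "adj G u v = c"
    unfolding monochromatic_insert by blast
  then have "{u, v} \<in> parts (mono_upto c r) G"
    using assms G v by (auto simp: parts_mono_upto monochromatic_insert adj_commute numeral_eq_enat
        numeral_2_eq_2)
  with u(1) show "\<exists>u\<in>verts G - {v}. {u, v} \<in> parts (mono_upto c r) G" by blast
qed (simp_all add: graph_property_mono_upto induced_hereditary_mono_upto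
    nonempty_property_mono_upto)

lemma cancellable_opposite_unbounded_imp_eq_1:
  assumes "cancellable (mono_upto c r) (mono_upto (\<not> c) \<infinity>)" "1 \<le> r"
  shows "r = 1"
proof -
  have "\<not> 2 \<le> r" using not_cancellable_opposite assms(1) by blast
  with assms(2) show ?thesis by (cases r) (auto simp: one_enat_def numeral_eq_enat)
qed

lemma unique_factorisation_imp_mono_upto_gprod
  [consumes 4, case_names same_colour opposite_colours]:
  assumes P: "graph_property P" "induced_hereditary P"
    and uniq: "unique_factorisation P" and red: "\<not> irreducible_property P"
  obtains c r s where "1 \<le> r" "1 \<le> s" "P = mono_upto c r \<odot> mono_upto c s"
  | c r s where "1 \<le> r" "1 \<le> s" "P = mono_upto c (enat r) \<odot> mono_upto (\<not> c) (enat s)"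
proof -
  obtain Q R where Q: "nonempty_property Q" and R: "nonempty_property R" and PQR: "P = Q \<odot> R"
    using reducibleE[OF P(1) red] by blast
  then have PRQ: "P = R \<odot> Q" by (simp add: gprod_commute)
  have cQ: "cancellable Q R" and cR: "cancellable R Q"
    using unique_factorisation_imp_cancellable Q R P(2) uniq PQR PRQ by metis+
  have "induced_hereditary Q" "induced_hereditary R"
    using cancellable_imp_hereditary Q R P(2) cQ cR PQR PRQ by metis+
  then obtain c r d s where r: "1 \<le> r" "Q = mono_upto c r" and s: "1 \<le> s" "R = mono_upto d s"
    using cancellable_imp_mono_upto Q R cQ cR by metis
  consider (same) "d = c" | (right_unbounded) "d = (\<not> c)" "s = \<infinity>"
    | (left_unbounded) "d = (\<not> c)" "r = \<infinity>" | (bounded) "d = (\<not> c)" "r \<noteq> \<infinity>" "s \<noteq> \<infinity>"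
    by blast
  then show ?thesis
  proof cases
    case same
    then show ?thesis using that(1) r s PQR by blast
  next
    case right_unbounded
    then have "r = 1" using cancellable_opposite_unbounded_imp_eq_1[of c r] cQ r s by simp
    then show ?thesis using that(1)[of 1 s d] mono_upto_1[of c d] r s PQR by simp
  next
    case left_unbounded
    then have "s = 1" using cancellable_opposite_unbounded_imp_eq_1[of d s] cR r s by simp
    then show ?thesis using that(1)[of r 1 c] mono_upto_1[of c d] r s PQR by simp
  next
    case bounded
    then obtain m n where "r = enat m" "s = enat n" by auto
    then show ?thesis using that(2)[of m n c] bounded r s PQR by (simp add: one_enat_def)
  qed
qed

section \<open>Uniqueness for factors of one colour\<close>

lemma unique_factorisation_gprodI:
  assumes M: "irreducible_property M" "induced_hereditary M" "M \<noteq> {}"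
    and N: "irreducible_property N" "induced_hereditary N" "N \<noteq> {}"
    and factors: "\<And>Q R. nonempty_property Q \<Longrightarrow> nonempty_property R \<Longrightarrow> Q \<odot> R = M \<odot> N \<Longrightarrow>
      {#Q, R#} = {#M, N#}"
  shows "unique_factorisation (M \<odot> N)"
proof -
  have props: "nonempty_property M" "nonempty_property N"
    using M N by (auto simp: nonempty_property_def irreducible_property_def)
  have "factorisation ([M] @ [N]) (M \<odot> N)"
    using factorisation_append[OF factorisation_singleton _ factorisation_singleton] M N by blast
  moreover have "mset Qs = mset ([M] @ [N])" if "factorisation Qs (M \<odot> N)" for Qs
    using that
  proof (cases rule: factorisation_cases)
    case irreducible
    have "M \<noteq> M \<odot> N" "N \<noteq> M \<odot> N"
      using irreducible_neq_gprod[OF M(1,2) props] irreducible_neq_gprod[OF N(1,2) props] .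
    then have "reducible_property (M \<odot> N)"
      using props unfolding reducible_property_def nonempty_property_def
      by (intro exI[of _ M] exI[of _ N]) simp
    then show ?thesis using irreducible(2) by (simp add: irreducible_property_def)
  next
    case (reducible Q Rs)
    then have QR: "{#Q, gprods Rs#} = {#M, N#}" by (intro factors) simp_all
    have "gprods Rs \<in># {#M, N#}" by (simp flip: QR)
    then have "gprods Rs = M \<or> gprods Rs = N" by simp
    then obtain K where K: "gprods Rs = K" "irreducible_property K" "induced_hereditary K"
      using M N by blast
    then have "Rs = [K]" using reducible(5) by (intro factorisation_irreducible) simp_all
    then show ?thesis using QR K(1) reducible(1) by simp
  qed
  ultimately show ?thesis unfolding unique_factorisation_def by blast
qed

lemma irreducible_mono_upto: "irreducible_property (mono_upto c s)"
proof (rule ccontr)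
  assume "\<not> irreducible_property (mono_upto c s)"
  then obtain Q R where Q: "nonempty_property Q" and R: "nonempty_property R"
    and eq: "mono_upto c s = Q \<odot> R"
    using reducibleE[OF graph_property_mono_upto] by blast
  obtain X x where X: "X \<in> Q" "x \<in> verts X" using Q by (rule nonempty_propertyE)
  obtain Y y where Y: "Y \<in> R" "y \<in> verts Y" using R by (rule nonempty_propertyE)
  have "glue (\<lambda>_ _. \<not> c) X Y \<in> mono_upto c s"
    using Q R X(1) Y(1) unfolding eq by (simp add: glue_in_gprod nonempty_property_def)
  then have "adj (glue (\<lambda>_ _. \<not> c) X Y) (inl x) (inr y) = c"
    using X Y by (intro monochromaticD[of c _ "verts (glue (\<lambda>_ _. \<not> c) X Y)"])
      (auto simp: mono_upto_def sum_encode_eq)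
  then show False using X Y by (simp add: adj_glue)
qed

lemma monochromatic_glue_cases [consumes 2, case_names left right]:
  assumes A: "A \<subseteq> verts (glue (\<lambda>_ _. \<not> c) X Y)" and mono: "monochromatic c (glue (\<lambda>_ _. \<not> c) X Y) A"
  obtains "A \<subseteq> inl ` verts X" | "A \<subseteq> inr ` verts Y"
proof (cases "A \<subseteq> inl ` verts X")
  case False
  then obtain y where y: "inr y \<in> A" "y \<in> verts Y" using A unfolding verts_glue by blast
  have "inl x \<notin> A" if x: "x \<in> verts X" for x
  proof
    assume "inl x \<in> A"
    then have "adj (glue (\<lambda>_ _. \<not> c) X Y) (inl x) (inr y) = c"
      using mono y(1) by (intro monochromaticD) (simp_all add: sum_encode_eq)
    then show False using x y(2) by (simp add: adj_glue)
  qed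
  then have "A \<subseteq> inr ` verts Y" using A unfolding verts_glue by blast
  then show ?thesis by (rule that(2))
qed (rule that(1))

lemma glue_in_gprod_monochromatic_iff:
  assumes Q: "graph_property Q" "Q \<subseteq> mono_upto c \<infinity>" and R: "graph_property R" "R \<subseteq> mono_upto c \<infinity>"
    and X: "X \<in> graphs" and Y: "Y \<in> graphs"
  shows "glue (\<lambda>_ _. \<not> c) X Y \<in> Q \<odot> R \<longleftrightarrow> X \<in> Q \<and> Y \<in> R \<or> X \<in> R \<and> Y \<in> Q"
proof
  let ?G = "glue (\<lambda>_ _. \<not> c) X Y"
  define L U where "L = inl ` verts X" and "U = inr ` verts Y"
  assume "?G \<in> Q \<odot> R"
  then obtain A B where G: "?G \<in> graphs" and A: "A \<in> parts Q ?G" and B: "B \<in> parts R ?G"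
    and AB: "A \<union> B = L \<union> U"
    unfolding L_def U_def by (elim gprodE) auto
  have side: "C \<subseteq> L \<or> C \<subseteq> U" if "C \<in> parts (mono_upto c \<infinity>) ?G" for C
    using that monochromatic_glue_cases[of C c X Y]
    unfolding parts_mono_upto[OF G] L_def U_def by blast
  have "A \<subseteq> L \<or> A \<subseteq> U" "B \<subseteq> L \<or> B \<subseteq> U"
    using A B parts_mono Q(2) R(2) by (blast intro!: side)+
  moreover have "L \<noteq> {}" "U \<noteq> {}" "L \<inter> U = {}"
    using verts_nonempty[OF X] verts_nonempty[OF Y] by (auto simp: L_def U_def sum_encode_eq)
  ultimately have "A \<subseteq> L \<and> B \<subseteq> U \<or> A \<subseteq> U \<and> B \<subseteq> L" using AB by auto
  then have "A = L \<and> B = U \<or> A = U \<and> B = L" using AB \<open>L \<inter> U = {}\<close> by auto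
  then show "X \<in> Q \<and> Y \<in> R \<or> X \<in> R \<and> Y \<in> Q"
    using A B inl_image_in_parts_iff[OF _ X Y] inr_image_in_parts_iff[OF _ X Y] Q(1) R(1)
    unfolding L_def U_def by blast
next
  assume "X \<in> Q \<and> Y \<in> R \<or> X \<in> R \<and> Y \<in> Q"
  then have "glue (\<lambda>_ _. \<not> c) X Y \<in> Q \<odot> R \<or> glue (\<lambda>_ _. \<not> c) X Y \<in> R \<odot> Q"
    using Q(1) R(1) glue_in_gprod by blast
  then show "glue (\<lambda>_ _. \<not> c) X Y \<in> Q \<odot> R" by (simp add: gprod_commute[of R])
qed

lemma card_le_add_card_Int: "Z \<subseteq> A \<union> B \<Longrightarrow> card Z \<le> card (A \<inter> Z) + card (B \<inter> Z)"
  using card_Un_le[of "A \<inter> Z" "B \<inter> Z"] by (simp add: Int_absorb1 flip: Int_Un_distrib2)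

lemma factor_subset_mono_upto:
  assumes Q: "nonempty_property Q" and R: "nonempty_property R"
    and sub: "Q \<odot> R \<subseteq> mono_upto c \<infinity> \<odot> mono_upto c \<infinity>"
  shows "Q \<subseteq> mono_upto c \<infinity>"
proof
  fix X assume X: "X \<in> Q"
  obtain Y y where Y: "Y \<in> R" "y \<in> verts Y" using R by (rule nonempty_propertyE)
  let ?G = "glue (\<lambda>_ _. \<not> c) X Y"
  have "?G \<in> Q \<odot> R" using Q R X Y by (simp add: glue_in_gprod nonempty_property_def)
  then have "?G \<in> mono_upto c \<infinity> \<odot> mono_upto c \<infinity>" using sub by blast
  then obtain A B where G: "?G \<in> graphs" and AB: "A \<union> B = verts ?G"
    and parts: "A \<in> parts (mono_upto c \<infinity>) ?G" "B \<in> parts (mono_upto c \<infinity>) ?G"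
    by (elim gprodE)
  have "adj X u v = c" if uv: "u \<in> verts X" "v \<in> verts X" "u \<noteq> v" for u v
  proof (rule ccontr)
    assume adj: "adj X u v \<noteq> c"
    let ?Z = "{inl u, inl v, inr y}"
    have "monochromatic (\<not> c) ?G ?Z"
      using adj adj_commute[of X v u] uv Y(2) by (auto simp: monochromatic_insert adj_glue)
    moreover have "finite A" "finite B" using parts by (simp_all add: finite_part[OF G])
    moreover have "monochromatic c ?G A" "monochromatic c ?G B"
      using parts unfolding parts_mono_upto[OF G] by blast+
    ultimately have le_1: "card (A \<inter> ?Z) \<le> 1" "card (B \<inter> ?Z) \<le> 1"
      using card_Int_monochromatic_le_1 by blast+
    have "?Z \<subseteq> A \<union> B" unfolding AB using uv Y(2) by simp
    then have "card ?Z \<le> card (A \<inter> ?Z) + card (B \<inter> ?Z)" by (rule card_le_add_card_Int)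
    with le_1 show False using uv(3) by (simp add: sum_encode_eq)
  qed
  moreover have "X \<in> graphs" using X Q
    by (auto simp: nonempty_property_def intro: property_in_graphs)
  ultimately show "X \<in> mono_upto c \<infinity>" by (simp add: mono_upto_def monochromatic_def pairwise_def)
qed

lemma symmetrised_Times_eqD:
  assumes eq: "A \<times> B \<union> B \<times> A = C \<times> D \<union> D \<times> C" and x: "x \<in> C" "x \<in> D"
  shows "A = C \<and> B = D \<or> A = D \<and> B = C"
proof (rule ccontr)
  have iff: "a \<in> A \<and> b \<in> B \<or> a \<in> B \<and> b \<in> A \<longleftrightarrow> a \<in> C \<and> b \<in> D \<or> a \<in> D \<and> b \<in> C" for a b
    using eq by (auto simp: set_eq_iff)
  have x': "x \<in> A" "x \<in> B" using iff[of x x] x by auto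
  have union: "a \<in> A \<or> a \<in> B \<longleftrightarrow> a \<in> C \<or> a \<in> D" for a
    using iff[of a x] x x' by blast
  have inter: "a \<in> A \<and> a \<in> B \<longleftrightarrow> a \<in> C \<and> a \<in> D" for a
    using iff[of a a] by blast
  assume "\<not> (A = C \<and> B = D \<or> A = D \<and> B = C)"
  then obtain y z where "(y \<in> A) \<noteq> (y \<in> C) \<or> (y \<in> B) \<noteq> (y \<in> D)"
    "(z \<in> A) \<noteq> (z \<in> D) \<or> (z \<in> B) \<noteq> (z \<in> C)"
    by blast
  then show False using iff[of y z] union[of y] union[of z] inter[of y] inter[of z] by blast
qed

lemma monochromatic_factors_unique:
  assumes M: "graph_property M" "M \<subseteq> mono_upto c \<infinity>" and N: "graph_property N" "N \<subseteq> mono_upto c \<infinity>"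
    and common: "K \<in> M" "K \<in> N"
    and Q: "nonempty_property Q" and R: "nonempty_property R" and eq: "Q \<odot> R = M \<odot> N"
  shows "{#Q, R#} = {#M, N#}"
proof -
  have sub: "Q \<odot> R \<subseteq> mono_upto c \<infinity> \<odot> mono_upto c \<infinity>"
    unfolding eq using M(2) N(2) by (rule gprod_mono)
  have Q': "graph_property Q" "Q \<subseteq> mono_upto c \<infinity>"
    using Q factor_subset_mono_upto[OF Q R sub] by (auto simp: nonempty_property_def)
  have R': "graph_property R" "R \<subseteq> mono_upto c \<infinity>"
    using R sub factor_subset_mono_upto[OF R Q, of c]
    by (simp_all add: nonempty_property_def gprod_commute[of R Q])
  have "X \<in> Q \<and> Y \<in> R \<or> X \<in> R \<and> Y \<in> Q \<longleftrightarrow> X \<in> M \<and> Y \<in> N \<or> X \<in> N \<and> Y \<in> M" for X Y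
  proof (cases "X \<in> graphs \<and> Y \<in> graphs")
    case True
    then show ?thesis
      using glue_in_gprod_monochromatic_iff[OF Q' R'] glue_in_gprod_monochromatic_iff[OF M N] eq
      by simp
  next
    case False
    then show ?thesis using Q'(1) R'(1) M(1) N(1) property_in_graphs by blast
  qed
  then have "Q \<times> R \<union> R \<times> Q = M \<times> N \<union> N \<times> M" unfolding set_eq_iff by simp
  then have "Q = M \<and> R = N \<or> Q = N \<and> R = M" using common by (rule symmetrised_Times_eqD)
  then show ?thesis by (auto simp: add_mset_commute)
qed

lemma unique_factorisation_mono_uptoI:
  assumes rs: "1 \<le> r" "1 \<le> s"
    and factors: "\<And>Q R. nonempty_property Q \<Longrightarrow> nonempty_property R \<Longrightarrow>
      Q \<odot> R = mono_upto c r \<odot> mono_upto d s \<Longrightarrow> {#Q, R#} = {#mono_upto c r, mono_upto d s#}"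
  shows "unique_factorisation (mono_upto c r \<odot> mono_upto d s)"
proof (rule unique_factorisation_gprodI)
  show "mono_upto c r \<noteq> {}" "mono_upto d s \<noteq> {}"
    using rs nonempty_property_mono_upto by (simp_all add: nonempty_property_def)
qed (rule irreducible_mono_upto induced_hereditary_mono_upto factors; assumption)+

lemma unique_factorisation_same_colour:
  assumes rs: "1 \<le> r" "1 \<le> s"
  shows "unique_factorisation (mono_upto c r \<odot> mono_upto c s)"
proof (rule unique_factorisation_mono_uptoI[OF rs])
  have "mono_graph c 1 \<in> mono_upto c r" "mono_graph c 1 \<in> mono_upto c s"
    using rs by (simp_all add: mono_graph_in_mono_upto one_enat_def)
  then show "{#Q, R#} = {#mono_upto c r, mono_upto c s#}"
    if "nonempty_property Q" "nonempty_property R" "Q \<odot> R = mono_upto c r \<odot> mono_upto c s" for Q R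
    using that
    by (intro monochromatic_factors_unique[where c = c] graph_property_mono_upto
        mono_upto_subset_unbounded)
qed

section \<open>Uniqueness for factors of opposite colours\<close>

text \<open>The induced \<open>2K\<^sub>2\<close> and \<open>C\<^sub>4\<close>, according to the colour of \<open>pq\<close>.\<close>

definition alternating_square :: "graph \<Rightarrow> nat \<Rightarrow> nat \<Rightarrow> nat \<Rightarrow> nat \<Rightarrow> bool" where
  "alternating_square G p q x y \<longleftrightarrow> {p, q, x, y} \<subseteq> verts G \<and> p \<noteq> q \<and> x \<noteq> y \<and> {p, q} \<inter> {x, y} = {} \<and>
     adj G x y = adj G p q \<and> (\<forall>u\<in>{p, q}. \<forall>v\<in>{x, y}. adj G u v \<noteq> adj G p q)"

lemma split_graph_no_alternating_square:
  assumes "G \<in> mono_upto c r \<odot> mono_upto (\<not> c) s"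
  shows "\<not> alternating_square G p q x y"
proof
  assume square: "alternating_square G p q x y"
  obtain A B where G: "G \<in> graphs" and AB: "A \<union> B = verts G"
    and "A \<in> parts (mono_upto c r) G" "B \<in> parts (mono_upto (\<not> c) s) G"
    using assms by (elim gprodE)
  then have mono: "monochromatic c G A" "monochromatic (\<not> c) G B"
    by (simp_all add: parts_mono_upto)
  define e where "e = adj G p q"
  obtain C D where CD: "C \<union> D = verts G"
    and C: "monochromatic e G C" and D: "monochromatic (\<not> e) G D"
    using AB mono by (cases "e = c") auto
  have "\<not> {p, q} \<subseteq> D" "\<not> {x, y} \<subseteq> D"
    using square D monochromaticD[OF D, of p q] monochromaticD[OF D, of x y]
    by (auto simp: alternating_square_def e_def)
  then obtain u v where "u \<in> {p, q}" "u \<in> C" "v \<in> {x, y}" "v \<in> C"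
    using square CD by (auto simp: alternating_square_def)
  then show False
    using square monochromaticD[OF C, of u v] by (auto simp: alternating_square_def e_def)
qed

lemma enat_card_le_if_split_graph:
  assumes "G \<in> mono_upto c r \<odot> mono_upto (\<not> c) s" "Z \<subseteq> verts G" "monochromatic c G Z"
  shows "enat (card Z) \<le> r + 1"
proof -
  obtain A B where G: "G \<in> graphs" and AB: "A \<union> B = verts G"
    and A: "A \<in> parts (mono_upto c r) G" and B: "B \<in> parts (mono_upto (\<not> c) s) G"
    using assms(1) by (elim gprodE)
  have "card Z \<le> card (A \<inter> Z) + card (B \<inter> Z)"
    using AB assms(2) by (intro card_le_add_card_Int) simp
  also have "card (A \<inter> Z) \<le> card A" using finite_part[OF G A] by (intro card_mono) auto
  also have "card (B \<inter> Z) \<le> 1"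
    using assms(3) B finite_part[OF G B]
    by (intro card_Int_monochromatic_le_1[of _ "\<not> c" G]) (simp_all add: parts_mono_upto[OF G])
  finally have "enat (card Z) \<le> enat (card A) + 1" by (simp add: one_enat_def)
  also have "\<dots> \<le> r + 1" using A by (intro add_right_mono) (simp add: parts_mono_upto[OF G])
  finally show ?thesis .
qed

lemma not_monochromatic_imp_lone_pair:
  assumes "\<nexists>d. monochromatic d G A"
  obtains u v w where "u \<in> A" "v \<in> A" "w \<in> A" "u \<noteq> v" "u \<noteq> w" "v \<noteq> w"
    "adj G u w \<noteq> adj G u v" "adj G v w \<noteq> adj G u v"
proof -
  have "\<not> monochromatic True G A" "\<not> monochromatic False G A" using assms by blast+
  then obtain a b a' b' where "a \<in> A" "b \<in> A" "a \<noteq> b" "adj G a b"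
    "a' \<in> A" "b' \<in> A" "a' \<noteq> b'" "\<not> adj G a' b'"
    by (auto simp: monochromatic_def pairwise_def)
  then obtain x y z where xyz: "x \<in> A" "y \<in> A" "z \<in> A" "x \<noteq> y" "x \<noteq> z" "adj G x y \<noteq> adj G x z"
    using adj_commute by metis
  then have "y \<noteq> z" by blast
  show ?thesis
  proof (cases "adj G y z = adj G x y")
    case True
    then show ?thesis using that[of x z y] xyz \<open>y \<noteq> z\<close> adj_commute[of G y z] by auto
  next
    case False
    then show ?thesis using that[of x y z] xyz \<open>y \<noteq> z\<close> by auto
  qed
qed

lemma card_monochromatic_glue_le:
  assumes X: "X \<in> graphs" and Y: "Y \<in> graphs" "monochromatic (\<not> c) Y (verts Y)"
    and A: "A \<subseteq> verts (glue (\<lambda>_ _. \<not> c) X Y)" "monochromatic c (glue (\<lambda>_ _. \<not> c) X Y) A"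
  shows "card A \<le> card (verts X)"
  using A
proof (cases rule: monochromatic_glue_cases)
  case left
  then have "card A \<le> card (inl ` verts X)" using X by (intro card_mono) (auto simp: finite_verts)
  then show ?thesis using card_image_le[OF finite_verts[OF X], of inl] by simp
next
  case right
  let ?G = "glue (\<lambda>_ _. \<not> c) X Y"
  have "finite A" using A(1) finite_verts[OF glue_in_graphs[OF X Y(1)]] by (rule finite_subset)
  moreover have "monochromatic (\<not> c) ?G (inr ` verts Y)"
    using Y(2) by (simp add: monochromatic_image_iff[OF embeds_inr])
  ultimately have "card (A \<inter> inr ` verts Y) \<le> 1"
    using A(2) by (intro card_Int_monochromatic_le_1)
  moreover have "A \<inter> inr ` verts Y = A" using right by blast
  ultimately show ?thesis using card_verts_pos[OF X] by simp
qed

lemma card_left_part_glue: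
  assumes X: "X \<in> graphs" and Y: "Y \<in> graphs" "monochromatic (\<not> c) Y (verts Y)"
    and A: "A \<in> parts (mono_upto c r) (glue (\<lambda>_ _. \<not> c) X Y)" and B: "card B \<le> card (verts Y)"
    and AB: "A \<union> B = verts (glue (\<lambda>_ _. \<not> c) X Y)" "A \<inter> B = {}"
  shows "card A = card (verts X)"
proof (rule antisym)
  have G: "glue (\<lambda>_ _. \<not> c) X Y \<in> graphs" using X Y(1) by (rule glue_in_graphs)
  show "card A \<le> card (verts X)"
    using A unfolding parts_mono_upto[OF G] by (intro card_monochromatic_glue_le[OF X Y]) blast+
  have "card A + card B = card (verts X) + card (verts Y)"
    using card_add_card_partition[OF G AB] card_verts_glue[OF X Y(1)] by simp
  then show "card (verts X) \<le> card A" using B by simp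
qed

locale split_factors =
  fixes Q R :: "graph set" and c :: bool and r s :: nat
  assumes left: "nonempty_property Q" and right: "nonempty_property R"
    and two_le: "2 \<le> r" "2 \<le> s"
    and product: "Q \<odot> R = mono_upto c (enat r) \<odot> mono_upto (\<not> c) (enat s)"
begin

lemma swap_factors: "split_factors R Q c r s"
  using left right two_le product by unfold_locales (simp_all add: gprod_commute[of R Q])

lemma swap_colours: "split_factors Q R (\<not> c) s r"
  using left right two_le product
  by unfold_locales (simp_all add: gprod_commute[of "mono_upto (\<not> c) (enat s)"])

lemma left_in_graphs: "X \<in> Q \<Longrightarrow> X \<in> graphs"
  using left property_in_graphs unfolding nonempty_property_def by blast

lemma right_in_graphs: "Y \<in> R \<Longrightarrow> Y \<in> graphs"
  using right property_in_graphs unfolding nonempty_property_def by blast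

lemma glue_in_product:
  assumes "X \<in> Q" "Y \<in> R"
  shows "glue C X Y \<in> mono_upto c (enat r) \<odot> mono_upto (\<not> c) (enat s)"
  using assms left right unfolding product[symmetric]
  by (simp add: glue_in_gprod nonempty_property_def)

lemma left_monochromatic:
  assumes X: "X \<in> Q"
  shows "\<exists>d. monochromatic d X (verts X)"
proof (rule ccontr)
  assume "\<nexists>d. monochromatic d X (verts X)"
  then obtain u v w where uvw: "u \<in> verts X" "v \<in> verts X" "w \<in> verts X" "u \<noteq> v" "u \<noteq> w" "v \<noteq> w"
    "adj X u w \<noteq> adj X u v" "adj X v w \<noteq> adj X u v"
    by (rule not_monochromatic_imp_lone_pair)
  obtain Y y where Y: "Y \<in> R" "y \<in> verts Y" using right by (rule nonempty_propertyE)
  let ?G = "glue (\<lambda>x _. if x = w then adj X u v else \<not> adj X u v) X Y"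
  have "alternating_square ?G (inl u) (inl v) (inl w) (inr y)"
    using uvw Y(2) by (simp add: alternating_square_def adj_glue sum_encode_eq)
  then show False using split_graph_no_alternating_square[OF glue_in_product[OF X Y(1)]] by blast
qed

lemma card_left_le:
  assumes X: "X \<in> Q" and mono: "monochromatic c X (verts X)"
  shows "card (verts X) \<le> r"
proof -
  obtain Y y where Y: "Y \<in> R" "y \<in> verts Y" using right by (rule nonempty_propertyE)
  let ?G = "glue (\<lambda>_ _. c) X Y" and ?Z = "insert (inr y) (inl ` verts X)"
  have "monochromatic c ?G (inl ` verts X)"
    using mono by (simp add: monochromatic_image_iff[OF embeds_inl])
  then have "monochromatic c ?G ?Z"
    using Y(2) by (auto simp: monochromatic_insert adj_glue)
  moreover have "?Z \<subseteq> verts ?G" using Y(2) by auto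
  ultimately have "enat (card ?Z) \<le> enat r + 1"
    using glue_in_product[OF X Y(1)] by (intro enat_card_le_if_split_graph)
  moreover have "card ?Z = Suc (card (verts X))"
    using finite_verts[OF left_in_graphs[OF X]]
    by (subst card_insert_disjoint) (auto simp: sum_encode_eq card_image inj_on_def)
  ultimately show ?thesis by (simp add: one_enat_def)
qed

lemma adj_left_neq_adj_right:
  assumes X: "X \<in> Q" "x \<in> verts X" "x' \<in> verts X" "x \<noteq> x'"
    and Y: "Y \<in> R" "y \<in> verts Y" "y' \<in> verts Y" "y \<noteq> y'"
  shows "adj X x x' \<noteq> adj Y y y'"
proof
  assume "adj X x x' = adj Y y y'"
  then have "alternating_square (glue (\<lambda>_ _. \<not> adj X x x') X Y) (inl x) (inl x') (inr y) (inr y')"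
    using X Y by (simp add: alternating_square_def adj_glue sum_encode_eq)
  then show False using split_graph_no_alternating_square[OF glue_in_product[OF X(1) Y(1)]] by blast
qed

text \<open>Otherwise all but one vertex of a split graph with parts of orders \<open>r\<close> and \<open>s\<close> form a
  monochromatic graph in \<open>Q\<close>, and there are too many of them.\<close>

lemma right_has_pair:
  "\<exists>Y\<in>R. \<exists>y\<in>verts Y. \<exists>y'\<in>verts Y. y \<noteq> y'"
proof (rule ccontr)
  assume no_pair: "\<not> (\<exists>Y\<in>R. \<exists>y\<in>verts Y. \<exists>y'\<in>verts Y. y \<noteq> y')"
  let ?G = "glue (\<lambda>_ _. c) (mono_graph c r) (mono_graph (\<not> c) s)"
  have "?G \<in> Q \<odot> R"
    unfolding product using two_le
    by (intro glue_in_gprod graph_property_mono_upto mono_graph_in_mono_upto) simp_all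
  then obtain A B where G: "?G \<in> graphs" and A: "A \<in> parts Q ?G" and B: "B \<in> parts R ?G"
    and AB: "A \<union> B = verts ?G" "A \<inter> B = {}"
    by (elim gprodE)
  have "card A + card B = card (verts ?G)" using G AB by (rule card_add_card_partition)
  also have "\<dots> = r + s" using two_le
    by (simp add: card_verts_glue mono_graph_in_graphs del: verts_glue)
  finally have "card A + card B = r + s" .
  moreover have "card B \<le> 1"
  proof (cases "B = {}")
    case False
    then have "induced ?G B \<in> R" using B by (simp add: parts_def)
    then have "\<forall>u\<in>B. \<forall>v\<in>B. u = v" using no_pair by fastforce
    moreover have "finite B" using G B by (rule finite_part)
    ultimately show ?thesis by (simp add: card_le_Suc0_iff_eq)
  qed simp
  ultimately have A_large: "r < card A" "s < card A" using two_le by auto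
  then have "A \<noteq> {}" by auto
  then have AQ: "induced ?G A \<in> Q" using A by (simp add: parts_def)
  then obtain d where "monochromatic d ?G A"
    using left_monochromatic[OF AQ] by auto
  then have "card A \<le> r \<or> card A \<le> s"
    using card_left_le[OF AQ] split_factors.card_left_le[OF swap_colours AQ] by (cases "d = c") auto
  then show False using A_large by simp
qed

lemma opposite_colours:
  obtains d where "Q \<subseteq> mono_upto d \<infinity>" "R \<subseteq> mono_upto (\<not> d) \<infinity>"
proof -
  obtain X x x' where X: "X \<in> Q" "x \<in> verts X" "x' \<in> verts X" "x \<noteq> x'"
    using split_factors.right_has_pair[OF swap_factors] by blast
  obtain Y y y' where Y: "Y \<in> R" "y \<in> verts Y" "y' \<in> verts Y" "y \<noteq> y'"
    using right_has_pair by blast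
  have "adj Z u v = adj X x x'" if "Z \<in> Q" "u \<in> verts Z" "v \<in> verts Z" "u \<noteq> v" for Z u v
    using adj_left_neq_adj_right[OF X Y] adj_left_neq_adj_right[OF that Y] by blast
  then have "Q \<subseteq> mono_upto (adj X x x') \<infinity>"
    using left_in_graphs by (simp add: mono_upto_def monochromatic_def pairwise_def subset_iff)
  moreover have "adj Z u v = (\<not> adj X x x')"
    if "Z \<in> R" "u \<in> verts Z" "v \<in> verts Z" "u \<noteq> v" for Z u v
    using adj_left_neq_adj_right[OF X that] by blast
  then have "R \<subseteq> mono_upto (\<not> adj X x x') \<infinity>"
    using right_in_graphs by (simp add: mono_upto_def monochromatic_def pairwise_def subset_iff)
  ultimately show ?thesis by (rule that)
qed

lemma left_subset_mono_upto:
  assumes "Q \<subseteq> mono_upto c \<infinity>"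
  shows "Q \<subseteq> mono_upto c (enat r)"
  using assms card_left_le by (auto simp: mono_upto_def)

lemma left_eq_mono_upto:
  assumes Q: "Q \<subseteq> mono_upto c \<infinity>" and R: "R \<subseteq> mono_upto (\<not> c) \<infinity>"
  shows "Q = mono_upto c (enat r)"
proof
  show Q_le: "Q \<subseteq> mono_upto c (enat r)" using Q by (rule left_subset_mono_upto)
  interpret swapped: split_factors R Q "\<not> c" s r
    by (rule split_factors.swap_colours[OF swap_factors])
  have R_le: "R \<subseteq> mono_upto (\<not> c) (enat s)" using R by (rule swapped.left_subset_mono_upto)
  show "mono_upto c (enat r) \<subseteq> Q"
  proof
    fix X assume X: "X \<in> mono_upto c (enat r)"
    then have gX: "X \<in> graphs" by (simp add: mono_upto_def)
    let ?Y = "mono_graph (\<not> c) s"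
    let ?G = "glue (\<lambda>_ _. \<not> c) X ?Y"
    have Y: "?Y \<in> mono_upto (\<not> c) (enat s)" using two_le by (intro mono_graph_in_mono_upto) simp_all
    have "?G \<in> Q \<odot> R"
      unfolding product using X Y by (intro glue_in_gprod graph_property_mono_upto)
    then obtain A B where G: "?G \<in> graphs" and AQ: "A \<in> parts Q ?G" and BR: "B \<in> parts R ?G"
      and AB: "A \<union> B = verts ?G" "A \<inter> B = {}"
      by (elim gprodE)
    have A: "A \<in> parts (mono_upto c (enat r)) ?G" and "B \<in> parts (mono_upto (\<not> c) (enat s)) ?G"
      using AQ BR parts_mono[OF Q_le] parts_mono[OF R_le] by blast+
    then have "monochromatic c ?G A" "card B \<le> s" by (simp_all add: parts_mono_upto[OF G])
    then have card_A: "card A = card (verts X)"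
      using Y AB by (intro card_left_part_glue[OF gX _ _ A]) (simp_all add: mono_upto_def)
    then have "A \<noteq> {}" using card_verts_pos[OF gX] by auto
    then have "induced ?G A \<in> Q" using AQ by (simp add: parts_def)
    moreover have "X \<in> Q \<longleftrightarrow> induced ?G A \<in> Q"
    proof (rule monochromatic_mem_iff)
      show "graph_property Q" using left by (simp add: nonempty_property_def)
      show "induced ?G A \<in> graphs" using \<open>induced ?G A \<in> Q\<close> by (rule left_in_graphs)
    qed (use X gX card_A \<open>monochromatic c ?G A\<close> in \<open>simp_all add: mono_upto_def\<close>)
    ultimately show "X \<in> Q" by blast
  qed
qed

lemma factors_eq: "{#Q, R#} = {#mono_upto c (enat r), mono_upto (\<not> c) (enat s)#}"
proof -
  interpret factors_swapped: split_factors R Q c r s by (rule swap_factors)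
  interpret colours_swapped: split_factors Q R "\<not> c" s r by (rule swap_colours)
  interpret both_swapped: split_factors R Q "\<not> c" s r by (rule factors_swapped.swap_colours)
  obtain d where d: "Q \<subseteq> mono_upto d \<infinity>" "R \<subseteq> mono_upto (\<not> d) \<infinity>"
    by (rule opposite_colours)
  show ?thesis
  proof (cases "d = c")
    case True
    then have "Q = mono_upto c (enat r)" "R = mono_upto (\<not> c) (enat s)"
      using d by (auto intro!: left_eq_mono_upto both_swapped.left_eq_mono_upto)
    then show ?thesis by simp
  next
    case False
    then have "d = (\<not> c)" by blast
    then have "Q = mono_upto (\<not> c) (enat s)" "R = mono_upto c (enat r)"
      using d colours_swapped.left_eq_mono_upto factors_swapped.left_eq_mono_upto by simp_all
    then show ?thesis by (simp add: add_mset_commute)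
  qed
qed

end

lemma unique_factorisation_opposite_colours:
  assumes "1 \<le> r" "1 \<le> s"
  shows "unique_factorisation (mono_upto c (enat r) \<odot> mono_upto (\<not> c) (enat s))"
proof -
  consider (left_singleton) "r = 1" | (right_singleton) "s = 1" | (large) "2 \<le> r" "2 \<le> s"
    using assms by linarith
  then show ?thesis
  proof cases
    case left_singleton
    then show ?thesis
      using unique_factorisation_same_colour[of 1 "enat s" "\<not> c"] assms(2) mono_upto_1[of c "\<not> c"]
      by (simp add: one_enat_def)
  next
    case right_singleton
    then show ?thesis
      using unique_factorisation_same_colour[of "enat r" 1 c] assms(1) mono_upto_1[of c "\<not> c"]
      by (simp add: one_enat_def)
  next
    case large
    show ?thesis
    proof (rule unique_factorisation_mono_uptoI)
      fix Q R assume "nonempty_property Q" "nonempty_property R"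
        "Q \<odot> R = mono_upto c (enat r) \<odot> mono_upto (\<not> c) (enat s)"
      with large have "split_factors Q R c r s" by unfold_locales
      then show "{#Q, R#} = {#mono_upto c (enat r), mono_upto (\<not> c) (enat s)#}"
        by (rule split_factors.factors_eq)
    qed (use assms in \<open>simp_all add: one_enat_def\<close>)
  qed
qed

theorem theorem3p1:
  fixes P :: "graph set"
  assumes "graph_property P" and "induced_hereditary P"
  shows "unique_factorisation P \<longleftrightarrow>
      irreducible_property P
    \<or> (\<exists>r s :: enat. 1 \<le> r \<and> 1 \<le> s \<and> P = edgeless_upto r \<odot> edgeless_upto s)
    \<or> (\<exists>r s :: enat. 1 \<le> r \<and> 1 \<le> s \<and> P = complete_upto r \<odot> complete_upto s)
    \<or> (\<exists>r s :: nat. 1 \<le> r \<and> 1 \<le> s \<and> P = edgeless_upto (enat r) \<odot> complete_upto (enat s))"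
    (is "_ \<longleftrightarrow> ?irreducible \<or> ?edgeless \<or> ?complete \<or> ?split")
proof
  assume uniq: "unique_factorisation P"
  show "?irreducible \<or> ?edgeless \<or> ?complete \<or> ?split"
  proof (cases ?irreducible)
    case False
    from assms uniq this show ?thesis
    proof (cases rule: unique_factorisation_imp_mono_upto_gprod)
      case (same_colour c r s)
      then show ?thesis
        unfolding edgeless_upto_eq_mono_upto complete_upto_eq_mono_upto by (cases c) auto
    next
      case (opposite_colours c r s)
      then have ?split
        unfolding edgeless_upto_eq_mono_upto complete_upto_eq_mono_upto
        by (cases c) (auto simp: gprod_commute)
      then show ?thesis by blast
    qed
  qed simp
next
  assume "?irreducible \<or> ?edgeless \<or> ?complete \<or> ?split"
  then show "unique_factorisation P"
    unfolding edgeless_upto_eq_mono_upto complete_upto_eq_mono_upto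
    using assms(2) irreducible_imp_unique_factorisation unique_factorisation_same_colour
      unique_factorisation_opposite_colours[of _ _ False] by auto
qed

end
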